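(* Let $N$ be a finite-dimensional smooth manifold, $\mathcal H_1,\mathcal H_2$ Hilbert spaces, $\tilde\Gamma_1^\infty$ a dense smooth submodule of $C^\infty(N,\mathcal H_1)$, $\tilde\Gamma_2^\infty$ a dense smooth submodule of $C^\infty(N,\mathcal H_2)$, and let $A=\{A(\lambda)\}_{\lambda\in N}$ be a field of bounded operators $A(\lambda):\mathcal H_1\to\mathcal H_2$ belonging to $\mathfrak A^\infty(\tilde\Gamma_1^\infty,\tilde\Gamma_2^\infty)$. Then $A$ is strongly smooth if and only if $\hat X_1\cdots\hat X_k(A)$ belongs to $C(N,\mathcal B(\mathcal H_1,\mathcal H_2)_{\ast\text{-}st})$ for every $k\ge 0$ and all $X_1,\dots,X_k\in\operatorname{Vect}(N)$ (for $k=0$ this field is $A$ itself).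
   Context: $C^\infty(N)$ denotes smooth complex functions, $\operatorname{Vect}(N)$ the complexified space of smooth vector fields on $N$. A dense smooth submodule $\Gamma$ of $C^\infty(N,\mathcal H)$ is a linear subspace of $C^\infty(N,\mathcal H)$, dense in its canonical Fréchet topology, such that $f\varphi\in\Gamma$ and $X(\varphi)\in\Gamma$ for all $f\in C^\infty(N)$, $X\in\operatorname{Vect}(N)$, $\varphi\in\Gamma$. A field of operators $A=\{A(\lambda)\}$, with $A(\lambda)$ an operator from a domain $D[A(\lambda)]\subseteq\mathcal H_1$ to $\mathcal H_2$, belongs to $\mathfrak A^\infty(\tilde\Gamma_1^\infty,\tilde\Gamma_2^\infty)$ if $\{\varphi(\lambda):\varphi\in\tilde\Gamma_1^\infty\}\subseteq D[A(\lambda)]$, $\{\psi(\lambda):\psi\in\tilde\Gamma_2^\infty\}\subseteq D[A^*(\lambda)]$ for all $\lambda$, and $A(\tilde\Gamma_1^\infty)\subseteq C^\infty(N,\mathcal H_2)$, $A^*(\tilde\Gamma_2^\infty)\subseteq C^\infty(N,\mathcal H_1)$, where $(A\varphi)(\lambda)=A(\lambda)\varphi(\lambda)$ and $(A^*\psi)(\lambda)=A^*(\lambda)\psi(\lambda)$. For such $A$ and $X\in\operatorname{Vect}(N)$, $\hat X(A)$ is the field of operators given on $\varphi\in\tilde\Gamma_1^\infty$ by $\hat X(A)\varphi=X(A\varphi)-A(X\varphi)$; this is well defined pointwise (on $\{\varphi(\lambda):\varphi\in\tilde\Gamma_1^\infty\}$) and again lies in $\mathfrak A^\infty(\tilde\Gamma_1^\infty,\tilde\Gamma_2^\infty)$,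 so the operation can be iterated. $A$ is strongly smooth if $\lambda\mapsto A(\lambda)x$ belongs to $C^\infty(N,\mathcal H_2)$ for every $x\in\mathcal H_1$. $\mathcal B(\mathcal H_1,\mathcal H_2)_{\ast\text{-}st}$ is the space of bounded operators with the $\ast$-strong topology; a field of densely defined operators is said to belong to $C(N,\mathcal B(\mathcal H_1,\mathcal H_2)_{\ast\text{-}st})$ if each operator extends to a bounded operator on $\mathcal H_1$ and the resulting map is continuous. *)

theory Defs
  imports "HOL-Analysis.Analysis"
begin

section \<open>Complex Hilbert spaces\<close>

class complex_hilbert_space = banach +
  fixes scaleC :: "complex \<Rightarrow> 'a \<Rightarrow> 'a"  (infixr "*\<^sub>C" 75)
    and cinner :: "'a \<Rightarrow> 'a \<Rightarrow> complex"
  assumes scaleC_add_right: "c *\<^sub>C (x + y) = c *\<^sub>C x + c *\<^sub>C y"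
    and scaleC_add_left: "(c + d) *\<^sub>C x = c *\<^sub>C x + d *\<^sub>C x"
    and scaleC_scaleC: "c *\<^sub>C (d *\<^sub>C x) = (c * d) *\<^sub>C x"
    and scaleC_one: "1 *\<^sub>C x = x"
    and scaleR_scaleC: "r *\<^sub>R x = complex_of_real r *\<^sub>C x"
    and cinner_commute: "cinner x y = cnj (cinner y x)"
    and cinner_add_right: "cinner x (y + z) = cinner x y + cinner x z"
    and cinner_scaleC_right: "cinner x (c *\<^sub>C y) = c * cinner x y"
    and cinner_self: "cinner x x = complex_of_real ((norm x)\<^sup>2)"

definition bounded_clinear ::
  "('a::complex_hilbert_space \<Rightarrow> 'b::complex_hilbert_space) \<Rightarrow> bool"
  where "bounded_clinear T \<longleftrightarrow> bounded_linear T \<and> (\<forall>c x. T (c *\<^sub>C x) = c *\<^sub>C T x)"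


section \<open>Operators with a domain\<close>

text \<open>A not necessarily bounded operator is a partial function; its domain is \<^term>\<open>dom T\<close>.\<close>

type_synonym ('a, 'b) operator = "'a \<rightharpoonup> 'b"

definition linear_operator ::
  "('a::complex_hilbert_space, 'b::complex_hilbert_space) operator \<Rightarrow> bool"
  where "linear_operator T \<longleftrightarrow>
    0 \<in> dom T \<and>
    (\<forall>h\<in>dom T. \<forall>k\<in>dom T. h + k \<in> dom T \<and> the (T (h + k)) = the (T h) + the (T k)) \<and>
    (\<forall>c. \<forall>h\<in>dom T. c *\<^sub>C h \<in> dom T \<and> the (T (c *\<^sub>C h)) = c *\<^sub>C the (T h))"

definition densely_defined :: "('a::complex_hilbert_space, 'b) operator \<Rightarrow> bool"
  where "densely_defined T \<longleftrightarrow> closure (dom T) = UNIV"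

text \<open>The Hilbert space adjoint of a densely defined operator (density makes the
  vector \<open>g\<close> unique).\<close>

definition adjoint_op ::
  "('a::complex_hilbert_space, 'b::complex_hilbert_space) operator \<Rightarrow> ('b, 'a) operator"
  where "adjoint_op T = (\<lambda>k.
    if \<exists>g. \<forall>h\<in>dom T. cinner k (the (T h)) = cinner g h
    then Some (THE g. \<forall>h\<in>dom T. cinner k (the (T h)) = cinner g h)
    else None)"

definition everywhere_defined :: "('a \<Rightarrow> 'b) \<Rightarrow> ('a, 'b) operator"
  where "everywhere_defined T = (\<lambda>h. Some (T h))"

text \<open>The space of bounded operators with the coarsest topology making all evaluations
  \<open>T \<mapsto> T h\<close> and \<open>T \<mapsto> T\<^sup>* k\<close> norm continuous.\<close>

definition star_strong_topology ::
  "('a::complex_hilbert_space \<Rightarrow> 'b::complex_hilbert_space) topology"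
  where "star_strong_topology = topology_generated_by
    ({{T. bounded_clinear T \<and> T h \<in> V} | h V. open V} \<union>
     {{T. bounded_clinear T \<and> the (adjoint_op (everywhere_defined T) k) \<in> V} | k V. open V})"


section \<open>Smooth maps between normed spaces\<close>

definition dir_deriv ::
  "'e::real_normed_vector \<Rightarrow> ('e \<Rightarrow> 'f::real_normed_vector) \<Rightarrow> 'e \<Rightarrow> 'f"
  where "dir_deriv v f z = frechet_derivative f (at z) v"

text \<open>Used only for open \<open>S\<close> in a finite-dimensional space, where differentiability of all
  iterated directional derivatives is the same as being infinitely Frechet
  differentiable.\<close>

definition smooth_on ::
  "'e::real_normed_vector set \<Rightarrow> ('e \<Rightarrow> 'f::real_normed_vector) \<Rightarrow> bool"
  where "smooth_on S f \<longleftrightarrow> (\<forall>vs. \<forall>z\<in>S. foldr dir_deriv vs f differentiable (at z))"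


section \<open>Manifolds\<close>

text \<open>A chart is a pair of its domain and its coordinate map. Only the values of the
  coordinate map on the domain matter. The model space is a normed space that is assumed
  to be finite-dimensional; the class \<^class>\<open>euclidean_space\<close> would exclude
  zero-dimensional manifolds.\<close>

type_synonym ('n, 'e) chart = "'n set \<times> ('n \<Rightarrow> 'e)"
type_synonym ('n, 'e) atlas = "('n, 'e) chart set"

definition smooth_manifold ::
  "('n::{t2_space, second_countable_topology}, 'e::real_normed_vector) atlas \<Rightarrow> bool"
  where "smooth_manifold N \<longleftrightarrow>
    (\<exists>B::'e set. finite B \<and> span B = UNIV) \<and>
    (\<forall>(U, x)\<in>N. open U \<and> open (x ` U) \<and> homeomorphism U (x ` U) x (inv_into U x)) \<and>
    (\<Union>(U, x)\<in>N. U) = UNIV \<and>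
    (\<forall>(U, x)\<in>N. \<forall>(V, y)\<in>N. smooth_on (x ` (U \<inter> V)) (y \<circ> inv_into U x))"

definition smooth_maps ::
  "('n, 'e::real_normed_vector) atlas \<Rightarrow> ('n \<Rightarrow> 'f::real_normed_vector) set"
  where "smooth_maps N = {\<phi>. \<forall>(U, x)\<in>N. smooth_on (x ` U) (\<phi> \<circ> inv_into U x)}"

text \<open>The canonical Frechet topology: uniform convergence of all derivatives in charts on
  compact subsets of the chart domains. The generating sets are the balls of the
  corresponding seminorms.\<close>

definition smooth_topology ::
  "('n::topological_space, 'e::real_normed_vector) atlas
    \<Rightarrow> ('n \<Rightarrow> 'f::real_normed_vector) topology"
  where "smooth_topology N = topology_generated_by
    {{\<psi> \<in> smooth_maps N. \<forall>p\<in>K.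
        norm (foldr dir_deriv vs (\<psi> \<circ> inv_into U x) (x p)
            - foldr dir_deriv vs (\<phi> \<circ> inv_into U x) (x p)) < \<epsilon>}
     | \<phi> U x K vs \<epsilon>. \<phi> \<in> smooth_maps N \<and> (U, x) \<in> N \<and> compact K \<and> K \<subseteq> U \<and> \<epsilon> > 0}"


section \<open>Vector fields\<close>

text \<open>A real tangent vector at \<open>p\<close> is a family of coordinate vectors, one for each chart
  around \<open>p\<close>, related by the derivatives of the coordinate changes. Accordingly
  \<open>Y (U, x) p\<close> is the coordinate representation of the vector field \<open>Y\<close> at \<open>p \<in> U\<close>
  in the chart \<open>(U, x)\<close>.\<close>

type_synonym ('n, 'e) vfield = "('n, 'e) chart \<Rightarrow> 'n \<Rightarrow> 'e"

definition smooth_vfields ::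
  "('n, 'e::real_normed_vector) atlas \<Rightarrow> ('n, 'e) vfield set"
  where "smooth_vfields N = {Y.
    (\<forall>(U, x)\<in>N. smooth_on (x ` U) (Y (U, x) \<circ> inv_into U x)) \<and>
    (\<forall>(U, x)\<in>N. \<forall>(V, y)\<in>N. \<forall>p\<in>U \<inter> V.
       Y (V, y) p = frechet_derivative (y \<circ> inv_into U x) (at (x p)) (Y (U, x) p))}"

text \<open>By the chain rule the result does not depend on the chart that is chosen.\<close>

definition vfield_apply ::
  "('n, 'e::real_normed_vector) atlas \<Rightarrow> ('n, 'e) vfield
    \<Rightarrow> ('n \<Rightarrow> 'f::real_normed_vector) \<Rightarrow> 'n \<Rightarrow> 'f"
  where "vfield_apply N Y \<phi> p =
    (let (U, x) = (SOME c. c \<in> N \<and> p \<in> fst c)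
     in frechet_derivative (\<phi> \<circ> inv_into U x) (at (x p)) (Y (U, x) p))"

text \<open>The complexified space of vector fields; the pair \<open>(Y, Z)\<close> stands for \<open>Y + \<i> Z\<close>.\<close>

type_synonym ('n, 'e) cvfield = "('n, 'e) vfield \<times> ('n, 'e) vfield"

definition Vect :: "('n, 'e::real_normed_vector) atlas \<Rightarrow> ('n, 'e) cvfield set"
  where "Vect N = smooth_vfields N \<times> smooth_vfields N"

definition cvfield_apply ::
  "('n, 'e::real_normed_vector) atlas \<Rightarrow> ('n, 'e) cvfield
    \<Rightarrow> ('n \<Rightarrow> 'h::complex_hilbert_space) \<Rightarrow> 'n \<Rightarrow> 'h"
  where "cvfield_apply N X \<phi> p =
    vfield_apply N (fst X) \<phi> p + \<i> *\<^sub>C vfield_apply N (snd X) \<phi> p"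


section \<open>Smooth fields of operators\<close>

definition dense_smooth_submodule ::
  "('n::topological_space, 'e::real_normed_vector) atlas
    \<Rightarrow> ('n \<Rightarrow> 'h::complex_hilbert_space) set \<Rightarrow> bool"
  where "dense_smooth_submodule N \<Gamma> \<longleftrightarrow>
    \<Gamma> \<subseteq> smooth_maps N \<and>
    (\<lambda>p. 0) \<in> \<Gamma> \<and>
    (\<forall>\<phi>\<in>\<Gamma>. \<forall>\<psi>\<in>\<Gamma>. (\<lambda>p. \<phi> p + \<psi> p) \<in> \<Gamma>) \<and>
    (\<forall>c. \<forall>\<phi>\<in>\<Gamma>. (\<lambda>p. c *\<^sub>C \<phi> p) \<in> \<Gamma>) \<and>
    smooth_topology N closure_of \<Gamma> = smooth_maps N \<and>
    (\<forall>f\<in>smooth_maps N. \<forall>\<phi>\<in>\<Gamma>. (\<lambda>p. f p *\<^sub>C \<phi> p) \<in> \<Gamma>) \<and>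
    (\<forall>X\<in>Vect N. \<forall>\<phi>\<in>\<Gamma>. cvfield_apply N X \<phi> \<in> \<Gamma>)"

type_synonym ('n, 'a, 'b) op_field = "'n \<Rightarrow> ('a, 'b) operator"

definition field_apply :: "('n, 'a, 'b) op_field \<Rightarrow> ('n \<Rightarrow> 'a) \<Rightarrow> 'n \<Rightarrow> 'b"
  where "field_apply A \<phi> = (\<lambda>p. the (A p (\<phi> p)))"

definition smooth_op_fields ::
  "('n, 'e::real_normed_vector) atlas
    \<Rightarrow> ('n \<Rightarrow> 'a::complex_hilbert_space) set \<Rightarrow> ('n \<Rightarrow> 'b::complex_hilbert_space) set
    \<Rightarrow> ('n, 'a, 'b) op_field set"
  where "smooth_op_fields N \<Gamma>1 \<Gamma>2 = {A.
    (\<forall>p. linear_operator (A p)) \<and>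
    (\<forall>p. {\<phi> p | \<phi>. \<phi> \<in> \<Gamma>1} \<subseteq> dom (A p)) \<and>
    (\<forall>p. {\<psi> p | \<psi>. \<psi> \<in> \<Gamma>2} \<subseteq> dom (adjoint_op (A p))) \<and>
    field_apply A ` \<Gamma>1 \<subseteq> smooth_maps N \<and>
    field_apply (\<lambda>p. adjoint_op (A p)) ` \<Gamma>2 \<subseteq> smooth_maps N}"

text \<open>The operator at \<open>p\<close> has domain \<open>{\<phi> p | \<phi>. \<phi> \<in> \<Gamma>1}\<close> and maps \<open>\<phi> p\<close> to
  \<open>(X(A \<phi>) - A(X \<phi>))(p)\<close>, which for fields in \<^const>\<open>smooth_op_fields\<close> depends on
  \<open>\<phi> p\<close> only.\<close>

definition field_deriv ::
  "('n, 'e::real_normed_vector) atlas \<Rightarrow> ('n \<Rightarrow> 'a::complex_hilbert_space) set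
    \<Rightarrow> ('n, 'e) cvfield \<Rightarrow> ('n, 'a, 'b::complex_hilbert_space) op_field
    \<Rightarrow> ('n, 'a, 'b) op_field"
  where "field_deriv N \<Gamma>1 X A = (\<lambda>p h.
    if \<exists>\<phi>\<in>\<Gamma>1. \<phi> p = h
    then Some (THE k. \<forall>\<phi>\<in>\<Gamma>1. \<phi> p = h \<longrightarrow>
      k = cvfield_apply N X (field_apply A \<phi>) p - field_apply A (cvfield_apply N X \<phi>) p)
    else None)"

definition strongly_smooth ::
  "('n, 'e::real_normed_vector) atlas
    \<Rightarrow> ('n \<Rightarrow> 'a::complex_hilbert_space \<Rightarrow> 'b::complex_hilbert_space) \<Rightarrow> bool"
  where "strongly_smooth N A \<longleftrightarrow> (\<forall>h. (\<lambda>p. A p h) \<in> smooth_maps N)"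

text \<open>Fields of densely defined operators whose bounded extensions form a continuous map
  into the bounded operators with the \<open>*\<close>-strong topology.\<close>

definition star_strong_continuous ::
  "('n::topological_space, 'a::complex_hilbert_space, 'b::complex_hilbert_space) op_field
    \<Rightarrow> bool"
  where "star_strong_continuous A \<longleftrightarrow>
    (\<forall>p. densely_defined (A p)) \<and>
    (\<exists>B. (\<forall>p. bounded_clinear (B p) \<and> (\<forall>h\<in>dom (A p). the (A p h) = B p h)) \<and>
         continuous_map euclidean star_strong_topology B)"

end

theory Submission
  imports Defs
begin

text \<open>
  Write \<open>X(A)\<close> for the derivative \<open>X(A \<phi>) - A (X \<phi>)\<close> of an operator field along a vector field.
  The product rule applied to \<open>\<langle>\<psi>, A \<phi>\<rangle> = \<langle>A\<^sup>* \<psi>, \<phi>\<rangle>\<close> shows that the adjoint of \<open>X(A)\<close> is the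
  derivative of the adjoint field along the conjugate of \<open>X\<close>
  (\<open>field_commutator_adjoint\<close>). Since the values \<open>\<psi>(p)\<close> are dense, \<open>X(A)\<close> acts pointwise, and a
  bounded extension of it lies again in the class of bounded fields that map \<open>\<Gamma>1\<close> to smooth
  sections and whose adjoints map \<open>\<Gamma>2\<close> to smooth sections
  (\<open>smooth_bounded_field_commutator_extension\<close>). Both directions of the theorem iterate one step
  within this class.

  If \<open>A\<close> is strongly smooth, then \<open>h \<mapsto> X(A h)(p)\<close> is a strong limit of difference quotients and
  hence a bounded operator by the uniform boundedness principle. It extends \<open>X(A)\<close> by the
  product rule, and it is again strongly smooth (\<open>strongly_smooth_field_derivative\<close>). Strong
  continuity of a field makes it uniformly bounded along convergent sequences. This bounds the
  adjoints too, so their strong continuity needs to be checked only on the dense set of values of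
  \<open>\<Gamma>2\<close>, where it is part of the hypothesis on adjoints (\<open>adjoint_field_continuous\<close>).

  Conversely, suppose that all iterated derivatives are strongly continuous, and fix a vector
  \<open>h\<close> and a chart. Approximate the constant section \<open>h\<close> by \<open>\<phi>\<^sub>n\<close> in \<open>\<Gamma>1\<close>, uniformly on a compact set and
  together with the first partial derivatives. For a vector field \<open>X\<close> that is locally a coordinate
  field, \<open>X(A \<phi>\<^sub>n) = X(A) \<phi>\<^sub>n + A (X \<phi>\<^sub>n)\<close> converges uniformly to \<open>X(A) h\<close>, because both
  operator fields are uniformly bounded on compact sets. So \<open>A h\<close> is differentiable with partial
  derivatives \<open>X(A) h\<close> (\<open>strong_derivative_from_commutators\<close>), and the same applies to each \<open>X(A)\<close>.
  Global vector fields that are locally coordinate fields come from smooth bump functions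
  (\<open>smooth_bump\<close>, \<open>coordinate_vfields\<close>).
\<close>


section \<open>Complex Hilbert spaces\<close>

lemma cinner_add_left: "cinner (x + y) z = cinner x z + cinner y z"
  for x y z :: "'a::complex_hilbert_space"
  by (metis cinner_commute cinner_add_right complex_cnj_add)

lemma cinner_scaleC_left: "cinner (c *\<^sub>C x) y = cnj c * cinner x y"
  for x y :: "'a::complex_hilbert_space"
  by (metis cinner_commute cinner_scaleC_right complex_cnj_mult)

lemma cinner_zero_right [simp]: "cinner x 0 = 0"
  for x :: "'a::complex_hilbert_space"
  using cinner_add_right[of x 0 0] by simp

lemma cinner_zero_left [simp]: "cinner 0 x = 0"
  for x :: "'a::complex_hilbert_space"
  using cinner_add_left[of 0 0 x] by simp

lemma cinner_minus_right: "cinner x (- y) = - cinner x y"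
  for x y :: "'a::complex_hilbert_space"
  using cinner_add_right[of x y "- y"] by (simp add: eq_neg_iff_add_eq_0 add.commute)

lemma cinner_minus_left: "cinner (- x) y = - cinner x y"
  for x y :: "'a::complex_hilbert_space"
  using cinner_add_left[of x "- x" y] by (simp add: eq_neg_iff_add_eq_0 add.commute)

lemma cinner_diff_right: "cinner x (y - z) = cinner x y - cinner x z"
  for x y z :: "'a::complex_hilbert_space"
  using cinner_add_right[of x y "- z"] by (simp add: cinner_minus_right)

lemma cinner_diff_left: "cinner (x - y) z = cinner x z - cinner y z"
  for x y z :: "'a::complex_hilbert_space"
  using cinner_add_left[of x "- y" z] by (simp add: cinner_minus_left)

lemma norm_scaleC: "norm (c *\<^sub>C x) = cmod c * norm x"
  for x :: "'a::complex_hilbert_space"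
proof -
  have "complex_of_real ((norm (c *\<^sub>C x))\<^sup>2) = cnj c * c * complex_of_real ((norm x)\<^sup>2)"
    by (simp add: cinner_self[symmetric] cinner_scaleC_left cinner_scaleC_right mult.assoc
        del: of_real_power)
  also have "\<dots> = complex_of_real ((cmod c * norm x)\<^sup>2)"
    by (simp add: power_mult_distrib complex_norm_square mult.commute del: of_real_power)
  finally have "(norm (c *\<^sub>C x))\<^sup>2 = (cmod c * norm x)\<^sup>2"
    using of_real_eq_iff by blast
  then show ?thesis
    by (simp add: power2_eq_iff_nonneg)
qed

lemma complex_Cauchy_Schwarz: "cmod (cinner x y) \<le> norm x * norm y"
  for x y :: "'a::complex_hilbert_space"
proof (cases "x = 0")
  case False
  define c where "c = cinner x y"
  define n where "n = (norm x)\<^sup>2"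
  have n: "n > 0"
    using False by (simp add: n_def)
  \<comment> \<open>\<open>n\<close> times the component of \<open>y\<close> orthogonal to \<open>x\<close>; the claim is that its norm is
    nonnegative.\<close>
  define z where "z = complex_of_real n *\<^sub>C y - c *\<^sub>C x"
  have xx: "cinner x x = of_real n" and yx: "cinner y x = cnj c"
    by (simp_all add: cinner_self n_def c_def cinner_commute[of y x] del: of_real_power)
  have "cinner x z = 0"
    by (simp add: z_def cinner_diff_right cinner_scaleC_right xx c_def[symmetric])
  then have "cinner z z = of_real n * cinner y z"
    by (simp add: z_def cinner_diff_left cinner_scaleC_left)
  also have "cinner y z = of_real n * of_real ((norm y)\<^sup>2) - c * cnj c"
    by (simp add: z_def cinner_diff_right cinner_scaleC_right yx cinner_self)
  also have "c * cnj c = of_real ((cmod c)\<^sup>2)"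
    using complex_norm_square by simp
  finally have "of_real ((norm z)\<^sup>2) = (of_real (n * (n * (norm y)\<^sup>2 - (cmod c)\<^sup>2)) :: complex)"
    by (simp add: cinner_self)
  then have "(norm z)\<^sup>2 = n * (n * (norm y)\<^sup>2 - (cmod c)\<^sup>2)"
    using of_real_eq_iff by blast
  then have "0 \<le> n * (n * (norm y)\<^sup>2 - (cmod c)\<^sup>2)"
    by (metis zero_le_power2)
  then have "(cmod c)\<^sup>2 \<le> (norm x * norm y)\<^sup>2"
    using n by (simp add: zero_le_mult_iff power_mult_distrib n_def)
  then show ?thesis
    by (simp add: c_def power2_le_iff_abs_le)
qed simp

lemma bounded_bilinear_cinner:
  "bounded_bilinear (cinner :: 'a::complex_hilbert_space \<Rightarrow> 'a \<Rightarrow> complex)"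
proof
  show "\<exists>K. \<forall>a b. cmod (cinner a b :: complex) \<le> norm (a::'a) * norm b * K"
    using complex_Cauchy_Schwarz by (intro exI[of _ 1]) auto
qed (simp_all add: cinner_add_left cinner_add_right scaleR_scaleC cinner_scaleC_left
      cinner_scaleC_right scaleR_conv_of_real)

lemma bounded_linear_scaleC: "bounded_linear (\<lambda>x::'a::complex_hilbert_space. c *\<^sub>C x)"
  by (rule bounded_linear_intro[of _ "cmod c"])
     (simp_all add: scaleC_add_right scaleR_scaleC scaleC_scaleC norm_scaleC mult.commute)

lemma scaleC_zero_right [simp]: "c *\<^sub>C (0::'a::complex_hilbert_space) = 0"
  using bounded_linear.linear[OF bounded_linear_scaleC] by (rule linear_0)

lemma bounded_clinear_bounded_linear: "bounded_clinear T \<Longrightarrow> bounded_linear T"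
  by (simp add: bounded_clinear_def)

text \<open>The difference of the two vectors is orthogonal to a dense set, hence to itself.\<close>

lemma cinner_dense_eqI:
  fixes u v :: "'a::complex_hilbert_space"
  assumes "closure D = UNIV" and "\<And>d. d \<in> D \<Longrightarrow> cinner d u = cinner d v"
  shows "u = v"
proof -
  interpret bounded_bilinear "cinner :: 'a \<Rightarrow> 'a \<Rightarrow> complex" by (rule bounded_bilinear_cinner)
  have "cinner (u - v) (u - v) = 0"
  proof (rule continuous_constant_on_closure[where f = "\<lambda>d. cinner d (u - v)"])
    show "continuous_on (closure D) (\<lambda>d. cinner d (u - v))"
      by (intro continuous_intros bounded_linear.continuous_on[OF bounded_linear_left])
    show "\<And>d. d \<in> D \<Longrightarrow> cinner d (u - v) = 0"
      using assms(2) by (simp add: cinner_diff_right)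
    show "u - v \<in> closure D"
      using assms(1) by simp
  qed
  then show ?thesis
    by (simp add: cinner_self)
qed


section \<open>Uniform boundedness\<close>

text \<open>The sets \<open>{x. \<exists>i\<in>I. norm (T i x) > n}\<close> are open with empty intersection, so by the
  Baire category theorem one of them misses a ball.\<close>

lemma uniform_boundedness:
  fixes T :: "'i \<Rightarrow> 'a::banach \<Rightarrow> 'b::real_normed_vector"
  assumes lin: "\<And>i. i \<in> I \<Longrightarrow> bounded_linear (T i)"
    and bdd: "\<And>x. \<exists>C. \<forall>i\<in>I. norm (T i x) \<le> C"
  obtains M where "M \<ge> 0" and "\<And>i x. i \<in> I \<Longrightarrow> norm (T i x) \<le> M * norm x"
proof -
  define G where "G n = {x. \<exists>i\<in>I. norm (T i x) > real n}" for n
  have open_G: "open (G n)" for n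
  proof -
    have "G n = (\<Union>i\<in>I. {x. real n < norm (T i x)})"
      by (auto simp: G_def)
    moreover have "open {x. real n < norm (T i x)}" if "i \<in> I" for i
      by (intro open_Collect_less continuous_intros linear_continuous_on lin that)
    ultimately show ?thesis by auto
  qed
  have "(\<Inter>n. G n) = {}"
  proof -
    have "\<exists>n. x \<notin> G n" for x
    proof -
      obtain C where C: "\<forall>i\<in>I. norm (T i x) \<le> C" using bdd by blast
      obtain n where "C \<le> real n" using real_arch_simple by blast
      with C have "x \<notin> G n" by (auto simp: G_def not_less intro: order_trans)
      then show ?thesis ..
    qed
    then show ?thesis by blast
  qed
  have "\<exists>n. closure (G n) \<noteq> UNIV"
  proof (rule ccontr)
    assume "\<nexists>n. closure (G n) \<noteq> UNIV"
    then have "Met_TC.mtopology closure_of \<Inter> (range G) = (UNIV :: 'a set)"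
      using open_G
      by (intro Met_TC.metric_Baire_category) (auto simp: complete_UNIV)
    with \<open>(\<Inter>n. G n) = {}\<close> show False by auto
  qed
  then obtain n x0 where "x0 \<notin> closure (G n)" by blast
  then obtain r where r: "r > 0" "ball x0 r \<inter> G n = {}"
    by (metis closure_iff_nhds_not_empty disjoint_iff inf.commute open_contains_ball open_ball
        closure_approachable dist_commute mem_ball)
  have bound: "norm (T i x) \<le> real n" if "i \<in> I" "dist x0 x < r" for i x
    using r that by (force simp: G_def)
  show thesis
  proof
    show "0 \<le> 4 * real n / r" using r by simp
    fix i x assume i: "i \<in> I"
    interpret T: bounded_linear "T i" by (rule lin[OF i])
    show "norm (T i x) \<le> (4 * real n / r) * norm x"
    proof (cases "x = 0")
      case False
      define s where "s = r / (2 * norm x)"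
      have s: "s > 0" using r False by (simp add: s_def)
      have "norm (s *\<^sub>R x) < r" using r False by (simp add: s_def)
      then have "norm (T i (x0 + s *\<^sub>R x)) \<le> n" "norm (T i x0) \<le> n"
        using bound[OF i] r by (simp_all add: dist_norm)
      moreover have "T i (x0 + s *\<^sub>R x) - T i x0 = s *\<^sub>R T i x"
        by (simp add: T.add T.scaleR)
      ultimately have "s * norm (T i x) \<le> 2 * n"
        using norm_triangle_ineq4[of "T i (x0 + s *\<^sub>R x)" "T i x0"] s by simp
      then show ?thesis
        using s r False by (simp add: s_def field_simps)
    qed (simp add: T.zero)
  qed
qed


lemma uniformly_bounded_of_convergent:
  fixes T :: "nat \<Rightarrow> 'a::banach \<Rightarrow> 'b::real_normed_vector"
  assumes "\<And>n. bounded_linear (T n)" and "\<And>h. (\<lambda>n. T n h) \<longlonglongrightarrow> S h"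
  obtains M where "M \<ge> 0" and "\<And>n h. norm (T n h) \<le> M * norm h"
proof -
  have "\<exists>C. \<forall>n\<in>UNIV. norm (T n h) \<le> C" for h
    using convergent_imp_Bseq[OF convergentI[OF assms(2)[of h]]] by (auto simp: Bseq_def)
  then obtain M where M: "M \<ge> 0" "\<And>n h. n \<in> UNIV \<Longrightarrow> norm (T n h) \<le> M * norm h"
    using uniform_boundedness[of UNIV T] assms(1) by auto
  show thesis
    by (rule that[OF M(1)]) (rule M(2)[OF UNIV_I])
qed

lemma bounded_linear_limit:
  fixes T :: "nat \<Rightarrow> 'a::banach \<Rightarrow> 'b::real_normed_vector"
  assumes "\<And>n. bounded_linear (T n)" and "\<And>h. (\<lambda>n. T n h) \<longlonglongrightarrow> S h"
  shows "bounded_linear S"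
proof -
  obtain M where M: "M \<ge> 0" "\<And>n h. norm (T n h) \<le> M * norm h"
    by (rule uniformly_bounded_of_convergent[OF assms]) (rule that, simp_all)
  show ?thesis
  proof (rule bounded_linear_intro)
    show "S (h + k) = S h + S k" for h k
    proof (rule LIMSEQ_unique[OF assms(2)])
      show "(\<lambda>n. T n (h + k)) \<longlonglongrightarrow> S h + S k"
        unfolding linear_add[OF bounded_linear.linear[OF assms(1)]]
        by (intro tendsto_add assms(2))
    qed
    show "S (r *\<^sub>R h) = r *\<^sub>R S h" for r h
    proof (rule LIMSEQ_unique[OF assms(2)])
      show "(\<lambda>n. T n (r *\<^sub>R h)) \<longlonglongrightarrow> r *\<^sub>R S h"
        unfolding linear_scale[OF bounded_linear.linear[OF assms(1)]]
        by (intro tendsto_scaleR tendsto_const assms(2))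
    qed
    show "norm (S h) \<le> norm h * M" for h
      using M(2)[of _ h] by (intro LIMSEQ_le_const2[OF tendsto_norm[OF assms(2)[of h]]])
        (simp add: mult.commute)
  qed
qed

text \<open>The operators are uniformly bounded, so \<open>T n (w n - w0)\<close> tends to zero.\<close>

lemma strong_limit_apply:
  fixes T :: "nat \<Rightarrow> 'a::banach \<Rightarrow> 'b::real_normed_vector"
  assumes "\<And>n. bounded_linear (T n)" and "\<And>h. (\<lambda>n. T n h) \<longlonglongrightarrow> S h" and "w \<longlonglongrightarrow> w0"
  shows "(\<lambda>n. T n (w n)) \<longlonglongrightarrow> S w0"
proof -
  obtain M where M: "M \<ge> 0" "\<And>n h. norm (T n h) \<le> M * norm h"
    by (rule uniformly_bounded_of_convergent[OF assms(1,2)]) (rule that, simp_all)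
  have "(\<lambda>n. T n (w n - w0)) \<longlonglongrightarrow> 0"
  proof (rule Lim_null_comparison)
    show "\<forall>\<^sub>F n in sequentially. norm (T n (w n - w0)) \<le> M * norm (w n - w0)"
      by (simp add: M(2))
    show "(\<lambda>n. M * norm (w n - w0)) \<longlonglongrightarrow> 0"
      by (intro tendsto_mult_right_zero tendsto_norm_zero LIM_zero assms(3))
  qed
  from tendsto_add[OF this assms(2)[of w0]] show ?thesis
    by (simp add: linear_diff[OF bounded_linear.linear[OF assms(1)]])
qed


section \<open>Finite-dimensional normed spaces\<close>

text \<open>That coordinates with bounded functionals exist on a finite-dimensional normed space is the
  equivalence of norms on such a space.\<close>

definition coordinate_system :: "'e::real_normed_vector set \<Rightarrow> ('e \<Rightarrow> 'e \<Rightarrow> real) \<Rightarrow> bool"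
  where "coordinate_system B c \<longleftrightarrow>
    finite B \<and> (\<forall>b. bounded_linear (c b)) \<and> (\<forall>v. v = (\<Sum>b\<in>B. c b v *\<^sub>R b))"

lemma coordinate_systemD:
  assumes "coordinate_system B c"
  shows "finite B" and "bounded_linear (c b)" and "(\<Sum>b\<in>B. c b v *\<^sub>R b) = v"
  using assms by (auto simp: coordinate_system_def)

lemma linear_coordinate_expansion:
  assumes "coordinate_system B c" and "linear f"
  shows "f v = (\<Sum>b\<in>B. c b v *\<^sub>R f b)"
proof -
  have "f v = f (\<Sum>b\<in>B. c b v *\<^sub>R b)"
    by (simp only: coordinate_systemD(3)[OF assms(1)])
  then show ?thesis
    by (simp add: linear_sum[OF assms(2)] linear_scale[OF assms(2)])
qed

lemma coordinate_system_real: "coordinate_system {1} (\<lambda>_ v. v :: real)"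
  by (simp add: coordinate_system_def bounded_linear_ident)

text \<open>Coefficient families are functions on the whole type, so that Tychonoff's theorem for the
  product topology applies; the coefficients outside \<open>B\<close> are pinned to zero.\<close>

lemma compact_function_cube:
  fixes B :: "'e set" and r :: real
  shows "compact {a :: 'e \<Rightarrow> real. (\<forall>b\<in>B. \<bar>a b\<bar> \<le> r) \<and> (\<forall>b. b \<notin> B \<longrightarrow> a b = 0)}"
proof -
  have eq: "{a :: 'e \<Rightarrow> real. (\<forall>b\<in>B. \<bar>a b\<bar> \<le> r) \<and> (\<forall>b. b \<notin> B \<longrightarrow> a b = 0)}
      = (\<Pi>\<^sub>E b\<in>UNIV. if b \<in> B then {-r..r} else {0})"
  proof (intro set_eqI iffI)
    fix a :: "'e \<Rightarrow> real"
    assume a: "a \<in> (\<Pi>\<^sub>E b\<in>UNIV. if b \<in> B then {-r..r} else {0})"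
    then have "a b \<in> (if b \<in> B then {-r..r} else {0})" for b
      by (auto simp: PiE_iff)
    then show "a \<in> {a. (\<forall>b\<in>B. \<bar>a b\<bar> \<le> r) \<and> (\<forall>b. b \<notin> B \<longrightarrow> a b = 0)}"
      by (force simp: abs_le_iff split: if_splits)
  qed (auto simp: PiE_iff abs_le_iff)
  have "compactin (product_topology (\<lambda>_. euclidean) UNIV)
      (\<Pi>\<^sub>E b\<in>(UNIV::'e set). if b \<in> B then {-r..r} else {0})"
    by (simp add: compactin_PiE)
  then show ?thesis
    by (simp add: eq euclidean_product_topology)
qed

lemma continuous_linear_combination:
  fixes B :: "'e::real_normed_vector set"
  shows "continuous_on S (\<lambda>a :: 'e \<Rightarrow> real. \<Sum>b\<in>B. a b *\<^sub>R b)"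
  by (intro continuous_intros continuous_on_subset[OF continuous_on_product_coordinates subset_UNIV])


text \<open>Since \<open>(\<Sum>b\<in>B. \<bar>a b\<bar>) = 1\<close> defines a compact set of coefficients, the norm of the
  combination is bounded below on it by a positive constant.\<close>

lemma independent_coefficients_bounded:
  fixes B :: "'e::real_normed_vector set"
  assumes "finite B" and "independent B"
  obtains C where "C > 0"
    and "\<And>a. (\<Sum>b\<in>B. \<bar>a b\<bar>) \<le> C * norm (\<Sum>b\<in>B. a b *\<^sub>R b)"
proof (cases "B = {}")
  case False
  define L where "L a = (\<Sum>b\<in>B. a b *\<^sub>R b)" for a :: "'e \<Rightarrow> real"
  define K where "K = {a :: 'e \<Rightarrow> real. (\<forall>b\<in>B. \<bar>a b\<bar> \<le> 1) \<and> (\<forall>b. b \<notin> B \<longrightarrow> a b = 0)}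
      \<inter> {a. (\<Sum>b\<in>B. \<bar>a b\<bar>) = 1}"
  have "closed {a :: 'e \<Rightarrow> real. (\<Sum>b\<in>B. \<bar>a b\<bar>) = 1}"
    by (intro closed_Collect_eq continuous_intros
        continuous_on_subset[OF continuous_on_product_coordinates subset_UNIV])
  then have "compact K"
    unfolding K_def by (rule compact_Int_closed[OF compact_function_cube])
  moreover have "continuous_on K (\<lambda>a. norm (L a))"
    unfolding L_def by (intro continuous_on_norm continuous_linear_combination)
  moreover have "K \<noteq> {}"
  proof -
    obtain b0 where "b0 \<in> B" using False by blast
    have "(\<Sum>b\<in>B. \<bar>if b = b0 then 1 else 0 :: real\<bar>) = (\<Sum>b\<in>B. if b = b0 then 1 else 0)"
      by (rule sum.cong) auto
    with \<open>b0 \<in> B\<close> have "(\<lambda>b. if b = b0 then 1 else 0) \<in> K"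
      using \<open>finite B\<close> by (auto simp: K_def)
    then show ?thesis by blast
  qed
  ultimately obtain a0 where a0: "a0 \<in> K" "\<And>a. a \<in> K \<Longrightarrow> norm (L a0) \<le> norm (L a)"
    using continuous_attains_inf[of K "\<lambda>a. norm (L a)"] by blast
  have "L a0 \<noteq> 0"
  proof
    assume "L a0 = 0"
    then have "\<forall>b\<in>B. a0 b = 0"
      using assms(2) dependent_finite[OF assms(1)] unfolding L_def by blast
    with a0(1) show False by (simp add: K_def)
  qed
  then have m: "norm (L a0) > 0" by simp
  show thesis
  proof
    show "1 / norm (L a0) > 0" using m by simp
    fix a :: "'e \<Rightarrow> real"
    define s where "s = (\<Sum>b\<in>B. \<bar>a b\<bar>)"
    have "s * norm (L a0) \<le> norm (L a)"
    proof (cases "s = 0")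
      case False
      then have s: "s > 0" by (simp add: s_def sum_nonneg less_le)
      define a' where "a' b = (if b \<in> B then a b / s else 0)" for b
      have sum': "(\<Sum>b\<in>B. \<bar>a' b\<bar>) = 1"
        using s by (simp add: a'_def s_def[symmetric] sum_divide_distrib[symmetric])
      have "\<bar>a' b\<bar> \<le> 1" if "b \<in> B" for b
        using member_le_sum[of b B "\<lambda>b. \<bar>a' b\<bar>"] that assms(1) sum' by simp
      with sum' have "a' \<in> K" by (simp add: K_def) (simp add: a'_def)
      then have "norm (L a0) \<le> norm (L a')" by (rule a0(2))
      also have "L a' = (1 / s) *\<^sub>R L a"
        by (simp add: L_def a'_def scaleR_sum_right divide_inverse mult.commute)
      finally show ?thesis using s by (simp add: field_simps)
    qed simp
    then show "(\<Sum>b\<in>B. \<bar>a b\<bar>) \<le> 1 / norm (L a0) * norm (\<Sum>b\<in>B. a b *\<^sub>R b)"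
      using m by (simp add: s_def L_def field_simps)
  qed
qed (use that[of 1] in auto)

lemma coordinate_system_exists:
  assumes "\<exists>B::'e::real_normed_vector set. finite B \<and> span B = UNIV"
  obtains B :: "'e::real_normed_vector set" and c where "coordinate_system B c"
proof -
  obtain B0 :: "'e set" where B0: "finite B0" "span B0 = UNIV" using assms by blast
  obtain B where B: "B \<subseteq> B0" "independent B" "B0 \<subseteq> span B"
    using maximal_independent_subset[of B0] by blast
  have fin: "finite B" using B(1) B0(1) by (rule finite_subset)
  have span: "span B = UNIV"
    using span_minimal[OF B(3) subspace_span] B0(2) by blast
  define c where "c b v = representation B v b" for b v
  have expand: "v = (\<Sum>b\<in>B. c b v *\<^sub>R b)" for v
    using sum_representation_eq[OF B(2) _ fin, of v] span by (simp add: c_def)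
  obtain C where C: "C > 0" "\<And>a. (\<Sum>b\<in>B. \<bar>a b\<bar>) \<le> C * norm (\<Sum>b\<in>B. a b *\<^sub>R b)"
    using independent_coefficients_bounded[OF fin B(2)] by blast
  have "bounded_linear (c b)" for b
  proof (cases "b \<in> B")
    case True
    show ?thesis
    proof (rule bounded_linear_intro)
      show "c b (x + y) = c b x + c b y" "c b (r *\<^sub>R x) = r *\<^sub>R c b x" for x y r
        using span by (simp_all add: c_def representation_add[OF B(2)] representation_scale[OF B(2)])
      have "\<bar>c b x\<bar> \<le> (\<Sum>b\<in>B. \<bar>c b x\<bar>)" for x
        using True fin by (intro member_le_sum) auto
      then show "norm (c b x) \<le> norm x * C" for x
        using C(2)[of "\<lambda>b. c b x"] expand[of x]
        by (simp add: mult.commute) (meson order_trans)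
    qed
  next
    case False
    then have "c b = (\<lambda>_. 0)"
      using representation_ne_zero[of B _ b] unfolding c_def by (intro ext) blast
    then show ?thesis by simp
  qed
  then show thesis
    using fin expand by (intro that[of B c]) (simp add: coordinate_system_def)
qed

lemma coordinates_bounded:
  assumes "coordinate_system B c"
  obtains C where "C > 0" and "\<And>b v. b \<in> B \<Longrightarrow> \<bar>c b v\<bar> \<le> C * norm v"
proof -
  have "\<exists>K>0. \<forall>v. norm (c b v) \<le> norm v * K" for b
    using bounded_linear.pos_bounded[OF coordinate_systemD(2)[OF assms]] .
  then obtain K where K: "\<And>b. K b > 0" "\<And>b v. \<bar>c b v\<bar> \<le> norm v * K b"
    by (metis real_norm_def)
  have fin: "finite B" using assms by (rule coordinate_systemD)
  show thesis
  proof
    show "1 + sum K B > 0"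
      using K(1) by (intro add_pos_nonneg sum_nonneg) (auto intro: less_imp_le)
    fix b v assume "b \<in> B"
    then have "K b \<le> 1 + sum K B"
      using member_le_sum[of b B K] fin K(1) by (force intro: less_imp_le)
    then show "\<bar>c b v\<bar> \<le> (1 + sum K B) * norm v"
      using K(2)[of b v] by (metis mult.commute mult_right_mono norm_ge_zero order_trans)
  qed
qed

text \<open>The ball is a closed subset of the image of a compact cube of coefficients.\<close>

lemma compact_cball_finite_dim:
  fixes z0 :: "'e::real_normed_vector" and B :: "'e set"
  assumes "coordinate_system B c"
  shows "compact (cball z0 r)"
proof -
  obtain C where C: "C > 0" "\<And>b v. b \<in> B \<Longrightarrow> \<bar>c b v\<bar> \<le> C * norm v"
    using coordinates_bounded[OF assms] by blast
  define Q where "Q = {a :: 'e \<Rightarrow> real. (\<forall>b\<in>B. \<bar>a b\<bar> \<le> C * r) \<and> (\<forall>b. b \<notin> B \<longrightarrow> a b = 0)}"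
  have "compact ((\<lambda>a. z0 + (\<Sum>b\<in>B. a b *\<^sub>R b)) ` Q)"
    unfolding Q_def
    by (intro compact_continuous_image compact_function_cube continuous_on_add
        continuous_on_const continuous_linear_combination)
  then have "compact ((\<lambda>a. z0 + (\<Sum>b\<in>B. a b *\<^sub>R b)) ` Q \<inter> cball z0 r)"
    by (rule compact_Int_closed) simp
  moreover have "cball z0 r \<subseteq> (\<lambda>a. z0 + (\<Sum>b\<in>B. a b *\<^sub>R b)) ` Q"
  proof
    fix z assume z: "z \<in> cball z0 r"
    define a where "a b = (if b \<in> B then c b (z - z0) else 0)" for b
    have "\<bar>a b\<bar> \<le> C * r" if "b \<in> B" for b
    proof -
      have "\<bar>a b\<bar> \<le> C * norm (z - z0)" using C(2)[OF that] that by (simp add: a_def)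
      also have "\<dots> \<le> C * r" using z C(1) by (simp add: dist_norm norm_minus_commute)
      finally show ?thesis .
    qed
    then have "a \<in> Q" by (simp add: Q_def a_def)
    moreover have "z = z0 + (\<Sum>b\<in>B. a b *\<^sub>R b)"
      using coordinate_systemD(3)[OF assms, of "z - z0"] by (simp add: a_def)
    ultimately show "z \<in> (\<lambda>a. z0 + (\<Sum>b\<in>B. a b *\<^sub>R b)) ` Q" by blast
  qed
  ultimately show ?thesis
    by (simp add: Int_absorb1)
qed


section \<open>Calculus of smooth maps\<close>

text \<open>Closure properties of smoothness are proved by induction on the number of derivatives.\<close>

definition differentiable_upto ::
  "nat \<Rightarrow> 'e::real_normed_vector set \<Rightarrow> ('e \<Rightarrow> 'f::real_normed_vector) \<Rightarrow> bool"
  where "differentiable_upto n S f \<longleftrightarrow>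
    (\<forall>vs. length vs \<le> n \<longrightarrow> (\<forall>z\<in>S. foldr dir_deriv vs f differentiable (at z)))"

lemma smooth_on_iff_upto: "smooth_on S f \<longleftrightarrow> (\<forall>n. differentiable_upto n S f)"
  unfolding smooth_on_def differentiable_upto_def by blast

lemma differentiable_upto_0: "differentiable_upto 0 S f \<longleftrightarrow> (\<forall>z\<in>S. f differentiable (at z))"
  by (simp add: differentiable_upto_def)

lemma differentiable_upto_Suc:
  fixes f :: "'e::real_normed_vector \<Rightarrow> 'f::real_normed_vector"
  shows "differentiable_upto (Suc n) S f \<longleftrightarrow>
    (\<forall>z\<in>S. f differentiable (at z)) \<and> (\<forall>v. differentiable_upto n S (dir_deriv v f))"
proof safe
  assume *: "differentiable_upto (Suc n) S f"
  show "f differentiable (at z)" if "z \<in> S" for z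
    using *[unfolded differentiable_upto_def, rule_format, of "[]" z] that by simp
  show "differentiable_upto n S (dir_deriv v f)" for v
    unfolding differentiable_upto_def
  proof (intro allI impI ballI)
    fix vs :: "'e list" and z assume "length vs \<le> n" "z \<in> S"
    then show "foldr dir_deriv vs (dir_deriv v f) differentiable (at z)"
      using *[unfolded differentiable_upto_def, rule_format, of "vs @ [v]" z] by simp
  qed
next
  assume *: "\<forall>z\<in>S. f differentiable (at z)" "\<forall>v. differentiable_upto n S (dir_deriv v f)"
  show "differentiable_upto (Suc n) S f"
    unfolding differentiable_upto_def
  proof (intro allI impI ballI)
    fix vs :: "'e list" and z assume vs: "length vs \<le> Suc n" and z: "z \<in> S"
    show "foldr dir_deriv vs f differentiable (at z)"
    proof (cases vs rule: rev_cases)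
      case (snoc ws w)
      then show ?thesis
        using *(2)[unfolded differentiable_upto_def, rule_format, of ws z w] vs z by simp
    qed (use * z in simp)
  qed
qed

lemma differentiable_upto_mono:
  "differentiable_upto n S f \<Longrightarrow> m \<le> n \<Longrightarrow> T \<subseteq> S \<Longrightarrow> differentiable_upto m T f"
  unfolding differentiable_upto_def by (auto dest: order_trans)

lemma differentiable_upto_SucD: "differentiable_upto (Suc n) S f \<Longrightarrow> differentiable_upto n S f"
  by (erule differentiable_upto_mono) auto

lemma differentiable_upto_dir_deriv:
  "differentiable_upto (Suc n) S f \<Longrightarrow> differentiable_upto n S (dir_deriv v f)"
  by (simp add: differentiable_upto_Suc)

lemma differentiable_uptoD: "differentiable_upto n S f \<Longrightarrow> z \<in> S \<Longrightarrow> f differentiable (at z)"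
  using differentiable_upto_mono[of n S f 0 S] by (simp add: differentiable_upto_0)

lemma dir_deriv_eq: "(f has_derivative f') (at z) \<Longrightarrow> dir_deriv v f z = f' v"
  unfolding dir_deriv_def by (metis frechet_derivative_at)

lemma frechet_derivative_cong_open:
  assumes "open S" and "\<And>z. z \<in> S \<Longrightarrow> f z = g z" and "z \<in> S"
  shows "frechet_derivative f (at z) = frechet_derivative g (at z)"
proof -
  have "(f has_derivative f') (at z) \<longleftrightarrow> (g has_derivative f') (at z)" for f'
    using has_derivative_transform_within_open[OF _ assms(1,3), of f _ UNIV g]
      has_derivative_transform_within_open[OF _ assms(1,3), of g _ UNIV f] assms(2) by auto
  then show ?thesis by (simp add: frechet_derivative_def)
qed

lemma dir_deriv_cong_open:
  assumes "open S" and "\<And>z. z \<in> S \<Longrightarrow> f z = g z" and "z \<in> S"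
  shows "dir_deriv v f z = dir_deriv v g z"
  using frechet_derivative_cong_open[OF assms] by (simp add: dir_deriv_def)

lemma differentiable_cong_open:
  assumes "open S" and "\<And>z. z \<in> S \<Longrightarrow> f z = g z" and "z \<in> S" and "f differentiable (at z)"
  shows "g differentiable (at z)"
  using assms(4) has_derivative_transform_within_open[OF _ assms(1,3), of f _ UNIV g] assms(2)
  unfolding differentiable_def by blast

lemma differentiable_upto_cong:
  assumes "open S" and "\<And>z. z \<in> S \<Longrightarrow> f z = g z" and "differentiable_upto n S f"
  shows "differentiable_upto n S g"
  using assms(2,3)
proof (induction n arbitrary: f g)
  case 0
  then show ?case
    unfolding differentiable_upto_0 using differentiable_cong_open[of S f g, OF assms(1)] by blast
next
  case (Suc n)
  have "differentiable_upto n S (dir_deriv v g)" for v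
  proof (rule Suc.IH)
    show "dir_deriv v f z = dir_deriv v g z" if "z \<in> S" for z
      by (rule dir_deriv_cong_open[OF assms(1) Suc.prems(1) that])
    show "differentiable_upto n S (dir_deriv v f)"
      by (rule differentiable_upto_dir_deriv[OF Suc.prems(2)])
  qed
  moreover have "g differentiable (at z)" if "z \<in> S" for z
    by (rule differentiable_cong_open[of S f g, OF assms(1) Suc.prems(1) that
          differentiable_uptoD[OF Suc.prems(2) that]])
  ultimately show ?case by (simp add: differentiable_upto_Suc)
qed

lemma differentiable_upto_SucI:
  assumes "open S"
    and "\<And>z. z \<in> S \<Longrightarrow> (f has_derivative f' z) (at z)"
    and "\<And>v. differentiable_upto n S (\<lambda>z. f' z v)"
  shows "differentiable_upto (Suc n) S f"
  unfolding differentiable_upto_Suc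
proof (intro conjI ballI allI)
  show "f differentiable (at z)" if "z \<in> S" for z
    using assms(2)[OF that] by (rule differentiableI)
  show "differentiable_upto n S (dir_deriv v f)" for v
    by (rule differentiable_upto_cong[OF assms(1) _ assms(3)[of v]])
       (simp add: dir_deriv_eq[OF assms(2)])
qed

lemma differentiable_upto_has_derivative:
  "differentiable_upto n S f \<Longrightarrow> z \<in> S \<Longrightarrow> (f has_derivative (\<lambda>v. dir_deriv v f z)) (at z)"
  unfolding dir_deriv_def using differentiable_uptoD frechet_derivative_works by blast

lemma differentiable_upto_const:
  fixes S :: "'e::real_normed_vector set" and c :: "'f::real_normed_vector"
  shows "differentiable_upto n S (\<lambda>_. c)"
proof (induction n arbitrary: c)
  case (Suc n)
  have "dir_deriv v (\<lambda>_. c) = (\<lambda>_. 0)" for v :: 'e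
    by (auto simp: dir_deriv_def)
  with Suc show ?case by (simp add: differentiable_upto_Suc)
qed (simp add: differentiable_upto_0)

lemma differentiable_upto_add:
  assumes "open S" and "differentiable_upto n S f" and "differentiable_upto n S g"
  shows "differentiable_upto n S (\<lambda>z. f z + g z)"
  using assms(2,3)
proof (induction n arbitrary: f g)
  case (Suc n)
  show ?case
  proof (rule differentiable_upto_SucI[OF assms(1)])
    show "((\<lambda>z. f z + g z) has_derivative (\<lambda>v. dir_deriv v f z + dir_deriv v g z)) (at z)"
      if "z \<in> S" for z
      using Suc.prems that by (intro has_derivative_add differentiable_upto_has_derivative)
    show "differentiable_upto n S (\<lambda>z. dir_deriv v f z + dir_deriv v g z)" for v
      by (intro Suc.IH differentiable_upto_dir_deriv Suc.prems)
  qed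
qed (simp add: differentiable_upto_0)

lemma differentiable_upto_sum:
  assumes "open S" and "\<And>i. i \<in> I \<Longrightarrow> differentiable_upto n S (f i)"
  shows "differentiable_upto n S (\<lambda>z. \<Sum>i\<in>I. f i z)"
  using assms(2)
  by (induction I rule: infinite_finite_induct)
     (simp_all add: differentiable_upto_const differentiable_upto_add[OF assms(1)])

lemma differentiable_upto_bounded_linear:
  assumes "open S" and "bounded_linear L" and "differentiable_upto n S f"
  shows "differentiable_upto n S (\<lambda>z. L (f z))"
  using assms(3)
proof (induction n arbitrary: f)
  case 0
  show ?case
    unfolding differentiable_upto_0
  proof
    fix z assume "z \<in> S"
    then show "(\<lambda>z. L (f z)) differentiable (at z)"
      using bounded_linear.has_derivative[OF assms(2) differentiable_upto_has_derivative[OF 0]]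
      by (blast intro: differentiableI)
  qed
next
  case (Suc n)
  show ?case
  proof (rule differentiable_upto_SucI[OF assms(1)])
    show "((\<lambda>z. L (f z)) has_derivative (\<lambda>v. L (dir_deriv v f z))) (at z)" if "z \<in> S" for z
      using Suc.prems that
      by (intro bounded_linear.has_derivative[OF assms(2)] differentiable_upto_has_derivative)
    show "differentiable_upto n S (\<lambda>z. L (dir_deriv v f z))" for v
      by (intro Suc.IH differentiable_upto_dir_deriv Suc.prems)
  qed
qed

lemma differentiable_upto_bilinear:
  assumes "open S" and "bounded_bilinear P"
    and "differentiable_upto n S f" and "differentiable_upto n S g"
  shows "differentiable_upto n S (\<lambda>z. P (f z) (g z))"
  using assms(3,4)
proof (induction n arbitrary: f g)
  case 0
  show ?case
    unfolding differentiable_upto_0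
  proof
    fix z assume "z \<in> S"
    then show "(\<lambda>z. P (f z) (g z)) differentiable (at z)"
      using bounded_bilinear.FDERIV[OF assms(2) differentiable_upto_has_derivative[OF 0(1)]
          differentiable_upto_has_derivative[OF 0(2)]] by (blast intro: differentiableI)
  qed
next
  case (Suc n)
  show ?case
  proof (rule differentiable_upto_SucI[OF assms(1)])
    show "((\<lambda>z. P (f z) (g z)) has_derivative
        (\<lambda>v. P (f z) (dir_deriv v g z) + P (dir_deriv v f z) (g z))) (at z)" if "z \<in> S" for z
      using Suc.prems that
      by (intro bounded_bilinear.FDERIV[OF assms(2)] differentiable_upto_has_derivative)
    show "differentiable_upto n S (\<lambda>z. P (f z) (dir_deriv v g z) + P (dir_deriv v f z) (g z))" for v
      by (intro differentiable_upto_add[OF assms(1)] Suc.IH differentiable_upto_SucD[OF Suc.prems(1)]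
          differentiable_upto_SucD[OF Suc.prems(2)] differentiable_upto_dir_deriv Suc.prems)
  qed
qed

text \<open>In coordinates of the intermediate space, a derivative of \<open>f \<circ> g\<close> is a sum of products
  of derivatives of components of \<open>g\<close> with compositions of derivatives of \<open>f\<close> with \<open>g\<close>.\<close>

lemma differentiable_upto_compose:
  fixes g :: "'d::real_normed_vector \<Rightarrow> 'e::real_normed_vector" and B :: "'e set"
  assumes "coordinate_system B c" and "open S" and "open T" and "g ` S \<subseteq> T"
    and "differentiable_upto n T f" and "differentiable_upto n S g"
  shows "differentiable_upto n S (\<lambda>z. f (g z))"
  using assms(5,6)
proof (induction n arbitrary: f)
  case 0
  have "(\<lambda>z. f (g z)) differentiable (at z)" if "z \<in> S" for z
  proof -
    have "f differentiable (at (g z))" "g differentiable (at z)"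
      using that assms(4) by (auto intro: differentiable_uptoD[OF 0(1)] differentiable_uptoD[OF 0(2)])
    then show ?thesis
      by (rule differentiable_chain_at[of g z f, unfolded o_def, rotated])
  qed
  then show ?case by (simp add: differentiable_upto_0)
next
  case (Suc n)
  show ?case
  proof (rule differentiable_upto_SucI[OF assms(2)])
    fix z assume z: "z \<in> S"
    have df: "(f has_derivative (\<lambda>v. dir_deriv v f (g z))) (at (g z))"
      using z assms(4) by (intro differentiable_upto_has_derivative[OF Suc.prems(1)]) auto
    have dg: "(g has_derivative (\<lambda>v. dir_deriv v g z)) (at z)"
      by (rule differentiable_upto_has_derivative[OF Suc.prems(2) z])
    have expand: "(\<lambda>v. dir_deriv (dir_deriv v g z) f (g z)) =
        (\<lambda>v. \<Sum>b\<in>B. c b (dir_deriv v g z) *\<^sub>R dir_deriv b f (g z))"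
      by (rule ext) (rule linear_coordinate_expansion[OF assms(1) has_derivative_linear[OF df]])
    show "((\<lambda>z. f (g z)) has_derivative
        (\<lambda>v. \<Sum>b\<in>B. c b (dir_deriv v g z) *\<^sub>R dir_deriv b f (g z))) (at z)"
      unfolding expand[symmetric] using diff_chain_at[OF dg df] by (simp only: o_def)
  next
    fix v
    have f: "differentiable_upto n T (dir_deriv b f)" for b
      by (rule differentiable_upto_dir_deriv[OF Suc.prems(1)])
    have g: "differentiable_upto n S g" "differentiable_upto n S (dir_deriv v g)"
      by (rule differentiable_upto_SucD[OF Suc.prems(2)])
         (rule differentiable_upto_dir_deriv[OF Suc.prems(2)])
    show "differentiable_upto n S (\<lambda>z. \<Sum>b\<in>B. c b (dir_deriv v g z) *\<^sub>R dir_deriv b f (g z))"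
    proof (rule differentiable_upto_sum[OF assms(2)],
        rule differentiable_upto_bilinear[OF assms(2) bounded_bilinear_scaleR])
      fix b
      show "differentiable_upto n S (\<lambda>z. c b (dir_deriv v g z))"
        by (rule differentiable_upto_bounded_linear
            [OF assms(2) coordinate_systemD(2)[OF assms(1)] g(2)])
      show "differentiable_upto n S (\<lambda>z. dir_deriv b f (g z))"
        by (rule Suc.IH[OF f g(1)])
    qed
  qed
qed

lemma smooth_on_cong:
  "open S \<Longrightarrow> (\<And>z. z \<in> S \<Longrightarrow> f z = g z) \<Longrightarrow> smooth_on S f \<Longrightarrow> smooth_on S g"
  unfolding smooth_on_iff_upto by (intro allI) (rule differentiable_upto_cong[of S f g], auto)

lemma smooth_on_Un: "smooth_on S f \<Longrightarrow> smooth_on T f \<Longrightarrow> smooth_on (S \<union> T) f"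
  unfolding smooth_on_def by blast

lemma smooth_on_dir_deriv: "smooth_on S f \<Longrightarrow> smooth_on S (dir_deriv v f)"
  unfolding smooth_on_iff_upto by (intro allI differentiable_upto_dir_deriv) blast

lemma smooth_on_differentiable: "smooth_on S f \<Longrightarrow> z \<in> S \<Longrightarrow> f differentiable (at z)"
  unfolding smooth_on_iff_upto by (blast intro: differentiable_uptoD[where n = 0])

lemma smooth_on_has_derivative:
  "smooth_on S f \<Longrightarrow> z \<in> S \<Longrightarrow> (f has_derivative (\<lambda>v. dir_deriv v f z)) (at z)"
  unfolding smooth_on_iff_upto by (rule differentiable_upto_has_derivative[of 0 S]) auto

lemma smooth_on_continuous_on: "smooth_on S f \<Longrightarrow> continuous_on S f"
  by (intro continuous_at_imp_continuous_on ballI differentiable_imp_continuous_within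
      smooth_on_differentiable)

lemma smooth_on_const: "smooth_on S (\<lambda>_. c)"
  by (simp add: smooth_on_iff_upto differentiable_upto_const)

lemma smooth_on_bounded_linear:
  "open S \<Longrightarrow> bounded_linear L \<Longrightarrow> smooth_on S f \<Longrightarrow> smooth_on S (\<lambda>z. L (f z))"
  unfolding smooth_on_iff_upto by (rule allI, rule differentiable_upto_bounded_linear[of S L _ f]) auto

lemma smooth_on_id: "open S \<Longrightarrow> smooth_on S (\<lambda>z. z)"
proof -
  assume S: "open S"
  have "differentiable_upto n S (\<lambda>z. z)" for n
  proof (cases n)
    case (Suc m)
    show ?thesis
      unfolding Suc
      by (rule differentiable_upto_SucI[OF S, where f' = "\<lambda>_ v. v"])
         (auto simp: differentiable_upto_const)
  qed (simp add: differentiable_upto_0)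
  then show ?thesis by (simp add: smooth_on_iff_upto)
qed

lemma smooth_on_add:
  "open S \<Longrightarrow> smooth_on S f \<Longrightarrow> smooth_on S g \<Longrightarrow> smooth_on S (\<lambda>z. f z + g z)"
  by (simp add: smooth_on_iff_upto differentiable_upto_add)

lemma smooth_on_diff:
  "open S \<Longrightarrow> smooth_on S f \<Longrightarrow> smooth_on S g \<Longrightarrow> smooth_on S (\<lambda>z. f z - g z)"
  using smooth_on_add[of S f "\<lambda>z. - g z"]
    smooth_on_bounded_linear[of S uminus g, OF _ bounded_linear_minus[OF bounded_linear_ident]] by simp

lemma smooth_on_sum:
  "open S \<Longrightarrow> (\<And>i. i \<in> I \<Longrightarrow> smooth_on S (f i)) \<Longrightarrow> smooth_on S (\<lambda>z. \<Sum>i\<in>I. f i z)"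
  by (simp add: smooth_on_iff_upto differentiable_upto_sum)

lemma smooth_on_bilinear:
  "open S \<Longrightarrow> bounded_bilinear P \<Longrightarrow> smooth_on S f \<Longrightarrow> smooth_on S g
    \<Longrightarrow> smooth_on S (\<lambda>z. P (f z) (g z))"
  unfolding smooth_on_iff_upto by (rule allI, rule differentiable_upto_bilinear[of S P _ f g]) auto

lemma smooth_on_compose:
  fixes g :: "'d::real_normed_vector \<Rightarrow> 'e::real_normed_vector" and B :: "'e set"
  shows "coordinate_system B c \<Longrightarrow> open S \<Longrightarrow> open T \<Longrightarrow> g ` S \<subseteq> T \<Longrightarrow> smooth_on T f \<Longrightarrow> smooth_on S g
    \<Longrightarrow> smooth_on S (\<lambda>z. f (g z))"
  unfolding smooth_on_iff_upto by (rule allI, rule differentiable_upto_compose[of B c S T g]) auto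

lemma smooth_on_frechet_derivative:
  fixes w :: "'e::real_normed_vector \<Rightarrow> 'e" and B :: "'e set"
  assumes "coordinate_system B c" and "open S" and "smooth_on S f" and "smooth_on S w"
  shows "smooth_on S (\<lambda>z. frechet_derivative f (at z) (w z))"
proof (rule smooth_on_cong)
  show "(\<Sum>b\<in>B. c b (w z) *\<^sub>R dir_deriv b f z) = frechet_derivative f (at z) (w z)" if "z \<in> S" for z
    using linear_coordinate_expansion[OF assms(1) linear_frechet_derivative
        [OF smooth_on_differentiable[OF assms(3) that]], of "w z"]
    by (simp add: dir_deriv_def)
  show "smooth_on S (\<lambda>z. \<Sum>b\<in>B. c b (w z) *\<^sub>R dir_deriv b f z)"
    by (intro smooth_on_sum smooth_on_bilinear[OF _ bounded_bilinear_scaleR] smooth_on_dir_deriv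
        smooth_on_bounded_linear[OF _ coordinate_systemD(2)[OF assms(1)]] assms)
qed (rule assms(2))


section \<open>Smooth bump functions\<close>

text \<open>Every derivative of \<open>exp (- 1 / t)\<close>, extended by zero to \<open>t \<le> 0\<close>, is a linear combination
  of these functions.\<close>

definition flat_exp :: "nat \<Rightarrow> real \<Rightarrow> real"
  where "flat_exp k t = (if t > 0 then (1 / t) ^ k * exp (- (1 / t)) else 0)"

lemma flat_exp_tendsto_0: "(flat_exp k \<longlongrightarrow> 0) (at 0)"
proof (rule filterlim_split_at)
  have "((\<lambda>t::real. 0) \<longlongrightarrow> (0::real)) (at_left 0)"
    by simp
  then show "(flat_exp k \<longlongrightarrow> 0) (at_left 0)"
  proof (rule Lim_transform_eventually)
    show "\<forall>\<^sub>F t in at_left 0. 0 = flat_exp k t"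
      by (auto simp: flat_exp_def eventually_at_filter)
  qed
  have "((\<lambda>t::real. inverse t ^ k / exp (inverse t)) \<longlongrightarrow> 0) (at_right 0)"
    by (rule filterlim_compose[OF tendsto_power_div_exp_0 filterlim_inverse_at_top_right])
  then show "(flat_exp k \<longlongrightarrow> 0) (at_right 0)"
  proof (rule Lim_transform_eventually)
    show "\<forall>\<^sub>F t in at_right 0. inverse t ^ k / exp (inverse t) = flat_exp k t"
      by (auto simp: flat_exp_def eventually_at_filter exp_minus field_simps)
  qed
qed

lemma flat_exp_has_derivative:
  "(flat_exp k has_real_derivative (flat_exp (k + 2) t - real k * flat_exp (k + 1) t)) (at t)"
proof -
  consider "t > 0" | "t < 0" | "t = 0" by linarith
  then show ?thesis
  proof cases
    case 1
    have "((\<lambda>t. (1 / t) ^ k * exp (- (1 / t))) has_real_derivative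
        (flat_exp (k + 2) t - real k * flat_exp (k + 1) t)) (at t)"
      using 1 by (cases k; auto intro!: derivative_eq_intros simp: flat_exp_def field_simps power2_eq_square)
         (metis One_nat_def power_eq_if)
    then show ?thesis
      by (rule has_field_derivative_transform_within_open[where S = "{0<..}"])
         (use 1 in \<open>auto simp: flat_exp_def\<close>)
  next
    case 2
    have "((\<lambda>t. 0) has_real_derivative 0) (at t)" by simp
    then have "(flat_exp k has_real_derivative 0) (at t)"
      by (rule has_field_derivative_transform_within_open[where S = "{..<0}"])
         (use 2 in \<open>auto simp: flat_exp_def\<close>)
    with 2 show ?thesis by (simp add: flat_exp_def)
  next
    case 3
    have "((\<lambda>h. (flat_exp k (0 + h) - flat_exp k 0) / h) \<longlongrightarrow> 0) (at 0)"
    proof (rule Lim_transform_eventually[OF flat_exp_tendsto_0[of "k + 1"]])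
      show "\<forall>\<^sub>F h in at 0. flat_exp (k + 1) h = (flat_exp k (0 + h) - flat_exp k 0) / h"
        by (auto simp: flat_exp_def eventually_at_filter)
    qed
    then show ?thesis
      using 3 by (simp add: DERIV_def flat_exp_def)
  qed
qed

lemma smooth_flat_exp: "smooth_on UNIV (flat_exp k)"
proof -
  have "differentiable_upto n UNIV (flat_exp k)" for n k
  proof (induction n arbitrary: k)
    case 0
    then show ?case
      using flat_exp_has_derivative by (auto simp: differentiable_upto_0 real_differentiable_def)
  next
    case (Suc n)
    show ?case
    proof (rule differentiable_upto_SucI)
      show "(flat_exp k has_derivative
          (\<lambda>v. v * flat_exp (k + 2) t + (- v * real k) * flat_exp (k + 1) t)) (at t)" for t
      proof -
        have "(*) (flat_exp (k + 2) t - real k * flat_exp (k + 1) t)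
            = (\<lambda>v. v * flat_exp (k + 2) t + (- v * real k) * flat_exp (k + 1) t)"
          by (rule ext) (simp add: algebra_simps)
        then show ?thesis
          using flat_exp_has_derivative[of k t] by (simp only: has_field_derivative_def)
      qed
      show "differentiable_upto n UNIV
          (\<lambda>t. v * flat_exp (k + 2) t + (- v * real k) * flat_exp (k + 1) t)" for v
        by (intro differentiable_upto_add Suc
            differentiable_upto_bounded_linear[OF _ bounded_linear_mult_right] open_UNIV)
    qed simp
  qed
  then show ?thesis by (simp add: smooth_on_iff_upto)
qed

text \<open>With \<open>e = flat_exp 0\<close> and \<open>q\<close> the sum of the squares of the coordinates around \<open>z0\<close>, the
  function \<open>e (e 1 - e (2 q / d - 1))\<close> is a positive constant for \<open>q < d / 2\<close>, where the inner
  \<open>e\<close> vanishes, and it is zero for \<open>q \<ge> d\<close>, where the inner value is at least \<open>e 1\<close>.\<close>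

lemma smooth_bump:
  fixes z0 :: "'e::real_normed_vector" and B :: "'e set"
  assumes cs: "coordinate_system B c" and "r > 0"
  obtains f :: "'e \<Rightarrow> real" and T where "smooth_on UNIV f" and "open T" and "z0 \<in> T"
    and "\<And>z. z \<in> T \<Longrightarrow> f z = 1" and "\<And>z. z \<notin> cball z0 r \<Longrightarrow> f z = 0"
proof -
  define q where "q z = (\<Sum>b\<in>B. c b (z - z0) * c b (z - z0))" for z
  define R where "R = 1 + (\<Sum>b\<in>B. norm b)"
  have R: "R > 0" by (simp add: R_def add_pos_nonneg sum_nonneg)
  \<comment> \<open>If \<open>q z < d\<close>, all coordinates are below \<open>r / R\<close>, which puts \<open>z\<close> into the ball.\<close>
  define d where "d = (r / R)\<^sup>2"
  have d: "d > 0" using \<open>r > 0\<close> R by (simp add: d_def)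
  define e where "e = flat_exp 0"
  have e1: "e 1 > 0" by (simp add: e_def flat_exp_def)
  have e_pos: "e t > 0 \<longleftrightarrow> t > 0" for t by (simp add: e_def flat_exp_def)
  have e_zero: "e t = 0" if "t \<le> 0" for t using that by (simp add: e_def flat_exp_def)
  have e_mono: "e 1 \<le> e t" if "1 \<le> t" for t
    using that by (simp add: e_def flat_exp_def)
  define f where "f z = e (e 1 - e ((2 / d) * q z + (-1))) / e (e 1)" for z
  have lin: "bounded_linear (c b)" for b by (rule coordinate_systemD[OF cs])
  have diff: "smooth_on UNIV (\<lambda>z. z - z0)"
    by (intro smooth_on_diff smooth_on_id smooth_on_const open_UNIV)
  have smooth_q: "smooth_on UNIV q"
    unfolding q_def
    by (intro smooth_on_sum smooth_on_bilinear[OF _ bounded_bilinear_mult]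
        smooth_on_bounded_linear[OF _ lin] diff open_UNIV)
  have smooth_e: "smooth_on UNIV e" by (simp add: e_def smooth_flat_exp)
  have smooth_inner: "smooth_on UNIV (\<lambda>z. e 1 - e ((2 / d) * q z + (-1)))"
    by (intro smooth_on_diff smooth_on_const smooth_on_add
        smooth_on_compose[OF coordinate_system_real open_UNIV open_UNIV subset_UNIV smooth_e]
        smooth_on_bounded_linear[OF _ bounded_linear_mult_right] smooth_q open_UNIV)
  show thesis
  proof
    show "smooth_on UNIV f"
      unfolding f_def
      by (intro smooth_on_bounded_linear[OF _ bounded_linear_divide] smooth_inner
          smooth_on_compose[OF coordinate_system_real open_UNIV open_UNIV subset_UNIV smooth_e] open_UNIV)
    show "open {z. q z < d / 2}"
      using smooth_on_continuous_on[OF smooth_q] by (intro open_Collect_less) auto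
    show "z0 \<in> {z. q z < d / 2}"
      using d by (simp add: q_def linear_0[OF bounded_linear.linear[OF lin]])
    show "f z = 1" if "z \<in> {z. q z < d / 2}" for z
    proof -
      have "(2 / d) * q z + (-1) \<le> 0" using that d by (simp add: field_simps)
      then have "e ((2 / d) * q z + (-1)) = 0" by (rule e_zero)
      then show ?thesis
        using e1 e_pos[of "e 1"] by (simp add: f_def)
    qed
    show "f z = 0" if "z \<notin> cball z0 r" for z
    proof -
      have "d \<le> q z"
      proof (rule ccontr)
        assume "\<not> d \<le> q z"
        have c: "\<bar>c b (z - z0)\<bar> \<le> r / R" if "b \<in> B" for b
        proof -
          have "(c b (z - z0))\<^sup>2 \<le> q z"
            unfolding q_def power2_eq_square
            using that coordinate_systemD(1)[OF cs]
            by (intro member_le_sum[where f = "\<lambda>b. c b (z - z0) * c b (z - z0)"]) auto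
          then have "(c b (z - z0))\<^sup>2 \<le> (r / R)\<^sup>2"
            using \<open>\<not> d \<le> q z\<close> by (simp add: d_def)
          then show ?thesis
            using \<open>r > 0\<close> R by (simp add: power2_le_iff_abs_le)
        qed
        have "norm (z - z0) = norm (\<Sum>b\<in>B. c b (z - z0) *\<^sub>R b)"
          by (simp only: coordinate_systemD(3)[OF cs])
        also have "\<dots> \<le> (\<Sum>b\<in>B. (r / R) * norm b)"
        proof (rule sum_norm_le)
          show "norm (c b (z - z0) *\<^sub>R b) \<le> (r / R) * norm b" if "b \<in> B" for b
            using mult_right_mono[OF c[OF that] norm_ge_zero[of b]] by simp
        qed
        also have "\<dots> = (r / R) * (R - 1)"
          by (simp add: R_def sum_distrib_left)
        also have "\<dots> \<le> r"
          using \<open>r > 0\<close> R by (simp add: field_simps)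
        finally show False
          using that by (simp add: dist_norm norm_minus_commute)
      qed
      then have "1 \<le> (2 / d) * q z + (-1)" using d by (simp add: field_simps)
      then show ?thesis
        using e_mono e_zero by (simp add: f_def)
    qed
  qed
qed


section \<open>Vector fields on a manifold\<close>

lemma smooth_manifold_chart:
  assumes "smooth_manifold N" and "(U, x) \<in> N"
  shows chart_open: "open U" and chart_open_image: "open (x ` U)"
    and chart_inv: "p \<in> U \<Longrightarrow> inv_into U x (x p) = p"
    and chart_inv_right: "z \<in> x ` U \<Longrightarrow> x (inv_into U x z) = z"
    and chart_inv_in: "z \<in> x ` U \<Longrightarrow> inv_into U x z \<in> U"
    and chart_continuous: "continuous_on U x"
    and chart_inv_continuous: "continuous_on (x ` U) (inv_into U x)"
proof -
  have *: "open U" "open (x ` U)" "homeomorphism U (x ` U) x (inv_into U x)"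
    using assms unfolding smooth_manifold_def by blast+
  then show "open U" "open (x ` U)" "p \<in> U \<Longrightarrow> inv_into U x (x p) = p"
    "continuous_on U x" "continuous_on (x ` U) (inv_into U x)"
    by (auto simp: homeomorphism_def)
  show "z \<in> x ` U \<Longrightarrow> x (inv_into U x z) = z" "z \<in> x ` U \<Longrightarrow> inv_into U x z \<in> U"
    by (rule f_inv_into_f, assumption) (rule inv_into_into)
qed

lemma chart_exists:
  assumes "smooth_manifold N"
  obtains U x where "(U, x) \<in> N" and "p \<in> U"
  using assms unfolding smooth_manifold_def by blast

lemma transition_smooth:
  assumes "smooth_manifold N" and "(U, x) \<in> N" and "(V, y) \<in> N"
  shows "smooth_on (x ` (U \<inter> V)) (y \<circ> inv_into U x)"
  using assms unfolding smooth_manifold_def by blast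

lemma open_chart_image:
  assumes "smooth_manifold N" and "(U, x) \<in> N" and "open W" and "W \<subseteq> U"
  shows "open (x ` W)"
proof -
  have "x ` W = x ` U \<inter> inv_into U x -` W"
    using assms(4) chart_inv[OF assms(1,2)] chart_inv_right[OF assms(1,2)]
    by (auto simp: image_iff)
  then show ?thesis
    using continuous_open_preimage[OF chart_inv_continuous[OF assms(1,2)]
        chart_open_image[OF assms(1,2)] assms(3)] by simp
qed

lemma smooth_mapsD: "\<phi> \<in> smooth_maps N \<Longrightarrow> (U, x) \<in> N \<Longrightarrow> smooth_on (x ` U) (\<phi> \<circ> inv_into U x)"
  unfolding smooth_maps_def by blast

lemma smooth_maps_continuous:
  assumes M: "smooth_manifold N" and "\<phi> \<in> smooth_maps N"
  shows "continuous_on UNIV \<phi>"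
proof (rule continuous_at_imp_continuous_on, rule ballI)
  fix p
  obtain U x where c: "(U, x) \<in> N" "p \<in> U"
    using chart_exists[OF M] by blast
  have "continuous_on U ((\<phi> \<circ> inv_into U x) \<circ> x)"
    by (intro continuous_on_compose chart_continuous[OF M c(1)] smooth_on_continuous_on
        smooth_mapsD[OF assms(2) c(1)])
  then have "continuous_on U \<phi>"
    by (rule continuous_on_eq) (simp add: chart_inv[OF M c(1)])
  then show "isCont \<phi> p"
    using c(2) chart_open[OF M c(1)] by (simp add: continuous_on_eq_continuous_at)
qed

context
  fixes N :: "('n::{t2_space, second_countable_topology}, 'e::real_normed_vector) atlas"
  assumes M: "smooth_manifold N"
begin

lemma model_coordinates:
  obtains B :: "'e set" and c where "coordinate_system B c"
  using coordinate_system_exists M unfolding smooth_manifold_def by metis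

lemma smooth_maps_const: "(\<lambda>_. a) \<in> smooth_maps N"
  by (auto simp: smooth_maps_def o_def smooth_on_const)

lemma smooth_maps_add:
  assumes "\<phi> \<in> smooth_maps N" and "\<psi> \<in> smooth_maps N"
  shows "(\<lambda>p. \<phi> p + \<psi> p) \<in> smooth_maps N"
  unfolding smooth_maps_def
  using smooth_on_add[OF chart_open_image[OF M] smooth_mapsD[OF assms(1)] smooth_mapsD[OF assms(2)]]
  by (auto simp: o_def)

lemma smooth_maps_diff:
  assumes "\<phi> \<in> smooth_maps N" and "\<psi> \<in> smooth_maps N"
  shows "(\<lambda>p. \<phi> p - \<psi> p) \<in> smooth_maps N"
  unfolding smooth_maps_def
  using smooth_on_diff[OF chart_open_image[OF M] smooth_mapsD[OF assms(1)] smooth_mapsD[OF assms(2)]]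
  by (auto simp: o_def)

lemma smooth_maps_bounded_linear:
  assumes "bounded_linear L" and "\<phi> \<in> smooth_maps N"
  shows "(\<lambda>p. L (\<phi> p)) \<in> smooth_maps N"
  unfolding smooth_maps_def
  using smooth_on_bounded_linear[OF chart_open_image[OF M] assms(1) smooth_mapsD[OF assms(2)]]
  by (auto simp: o_def)

lemma smooth_maps_scaleC: "\<phi> \<in> smooth_maps N \<Longrightarrow> (\<lambda>p. a *\<^sub>C \<phi> p) \<in> smooth_maps N"
  by (rule smooth_maps_bounded_linear[OF bounded_linear_scaleC])

lemma chart_change_derivative:
  assumes "(U, x) \<in> N" and "(V, y) \<in> N" and p: "p \<in> U \<inter> V"
    and "(\<phi> \<circ> inv_into V y) differentiable (at (y p))"
  shows "frechet_derivative (\<phi> \<circ> inv_into U x) (at (x p)) v =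
    frechet_derivative (\<phi> \<circ> inv_into V y) (at (y p))
      (frechet_derivative (y \<circ> inv_into U x) (at (x p)) v)"
proof -
  have yx: "(y \<circ> inv_into U x) (x p) = y p"
    using p chart_inv[OF M assms(1)] by simp
  have "frechet_derivative (\<phi> \<circ> inv_into U x) (at (x p)) =
      frechet_derivative ((\<phi> \<circ> inv_into V y) \<circ> (y \<circ> inv_into U x)) (at (x p))"
  proof (rule frechet_derivative_cong_open)
    show "open (x ` (U \<inter> V))"
      by (intro open_chart_image[OF M assms(1)] open_Int chart_open[OF M assms(1)]
          chart_open[OF M assms(2)]) auto
    show "(\<phi> \<circ> inv_into U x) z = ((\<phi> \<circ> inv_into V y) \<circ> (y \<circ> inv_into U x)) z"
      if "z \<in> x ` (U \<inter> V)" for z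
      using that by (auto simp: chart_inv[OF M assms(1)] chart_inv[OF M assms(2)])
  qed (use p in simp)
  also have "\<dots> = frechet_derivative (\<phi> \<circ> inv_into V y) (at (y p)) \<circ>
      frechet_derivative (y \<circ> inv_into U x) (at (x p))"
  proof -
    have "(y \<circ> inv_into U x) differentiable (at (x p))"
      using smooth_on_differentiable[OF transition_smooth[OF M assms(1,2)]] p by blast
    then show ?thesis
      using frechet_derivative_compose[of "y \<circ> inv_into U x" "x p" "\<phi> \<circ> inv_into V y"] assms(4)
      unfolding yx by blast
  qed
  finally show ?thesis by simp
qed

lemma vfield_apply_chart:
  assumes Y: "Y \<in> smooth_vfields N" and \<phi>: "\<phi> \<in> smooth_maps N"
    and c: "(U, x) \<in> N" and p: "p \<in> U"
  shows "vfield_apply N Y \<phi> p = frechet_derivative (\<phi> \<circ> inv_into U x) (at (x p)) (Y (U, x) p)"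
proof -
  obtain V y where Vy: "(V, y) = (SOME c. c \<in> N \<and> p \<in> fst c)"
    by (metis surj_pair)
  have "(SOME c. c \<in> N \<and> p \<in> fst c) \<in> N \<and> p \<in> fst (SOME c. c \<in> N \<and> p \<in> fst c)"
    by (rule someI[of "\<lambda>c. c \<in> N \<and> p \<in> fst c" "(U, x)"]) (use c p in simp)
  then have V: "(V, y) \<in> N" "p \<in> V"
    unfolding Vy[symmetric] by simp_all
  have "vfield_apply N Y \<phi> p = frechet_derivative (\<phi> \<circ> inv_into V y) (at (y p)) (Y (V, y) p)"
    unfolding vfield_apply_def Vy[symmetric] by simp
  also have "Y (V, y) p = frechet_derivative (y \<circ> inv_into U x) (at (x p)) (Y (U, x) p)"
    using Y c V p unfolding smooth_vfields_def by blast
  also have "frechet_derivative (\<phi> \<circ> inv_into V y) (at (y p)) \<dots> =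
      frechet_derivative (\<phi> \<circ> inv_into U x) (at (x p)) (Y (U, x) p)"
    using V p smooth_on_differentiable[OF smooth_mapsD[OF \<phi> V(1)], of "y p"]
    by (intro chart_change_derivative[symmetric] c) auto
  finally show ?thesis .
qed

text \<open>In a chart, the derivative along \<open>Y\<close> is the sum of the partial derivatives multiplied by
  the coordinates of \<open>Y\<close>.\<close>

lemma vfield_apply_smooth:
  assumes Y: "Y \<in> smooth_vfields N" and \<phi>: "\<phi> \<in> smooth_maps N"
  shows "vfield_apply N Y \<phi> \<in> smooth_maps N"
  unfolding smooth_maps_def
proof (clarsimp simp: o_def)
  fix U x assume c: "(U, x) \<in> N"
  obtain B c where cs: "coordinate_system (B :: 'e set) c"
    by (rule model_coordinates)
  show "smooth_on (x ` U) (\<lambda>z. vfield_apply N Y \<phi> (inv_into U x z))"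
  proof (rule smooth_on_cong)
    show "open (x ` U)" by (rule chart_open_image[OF M c])
    have "smooth_on (x ` U) (Y (U, x) \<circ> inv_into U x)"
      using Y c unfolding smooth_vfields_def by blast
    then show "smooth_on (x ` U)
        (\<lambda>z. frechet_derivative (\<phi> \<circ> inv_into U x) (at z) ((Y (U, x) \<circ> inv_into U x) z))"
      by (rule smooth_on_frechet_derivative[OF cs chart_open_image[OF M c] smooth_mapsD[OF \<phi> c]])
    show "frechet_derivative (\<phi> \<circ> inv_into U x) (at z) ((Y (U, x) \<circ> inv_into U x) z) =
        vfield_apply N Y \<phi> (inv_into U x z)" if "z \<in> x ` U" for z
      by (simp add: vfield_apply_chart[OF Y \<phi> c chart_inv_in[OF M c that]]
          chart_inv_right[OF M c that])
  qed
qed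

lemma cvfield_apply_smooth:
  assumes "X \<in> Vect N" and "\<phi> \<in> smooth_maps N"
  shows "cvfield_apply N X \<phi> \<in> smooth_maps N"
proof -
  have "(\<lambda>p. vfield_apply N (fst X) \<phi> p + \<i> *\<^sub>C vfield_apply N (snd X) \<phi> p) \<in> smooth_maps N"
    using assms by (intro smooth_maps_add smooth_maps_scaleC vfield_apply_smooth)
      (auto simp: Vect_def)
  then show ?thesis by (simp add: cvfield_apply_def[abs_def])
qed

lemma zero_vfield: "(\<lambda>_ _. 0) \<in> smooth_vfields N"
proof -
  have "frechet_derivative (y \<circ> inv_into U x) (at (x p)) 0 = 0"
    if "(U, x) \<in> N" "(V, y) \<in> N" "p \<in> U" "p \<in> V" for U x V y p
    using smooth_on_differentiable[OF transition_smooth[OF M that(1,2)]] that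
    by (intro linear_0 linear_frechet_derivative) blast
  then show ?thesis
    by (auto simp: smooth_vfields_def o_def smooth_on_const)
qed

lemma minus_vfield:
  assumes Y: "Y \<in> smooth_vfields N"
  shows "(\<lambda>c p. - Y c p) \<in> smooth_vfields N"
proof -
  have "- Y (V, y) p = frechet_derivative (y \<circ> inv_into U x) (at (x p)) (- Y (U, x) p)"
    if "(U, x) \<in> N" "(V, y) \<in> N" "p \<in> U" "p \<in> V" for U x V y p
  proof -
    have "linear (frechet_derivative (y \<circ> inv_into U x) (at (x p)))"
      using smooth_on_differentiable[OF transition_smooth[OF M that(1,2)]] that
      by (intro linear_frechet_derivative) blast
    moreover have "Y (V, y) p = frechet_derivative (y \<circ> inv_into U x) (at (x p)) (Y (U, x) p)"
      using Y that unfolding smooth_vfields_def by blast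
    ultimately show ?thesis by (simp add: linear_neg)
  qed
  moreover have "smooth_on (x ` U) ((\<lambda>p. - Y (U, x) p) \<circ> inv_into U x)" if "(U, x) \<in> N" for U x
  proof -
    have "smooth_on (x ` U) (Y (U, x) \<circ> inv_into U x)"
      using Y that unfolding smooth_vfields_def by blast
    then have "smooth_on (x ` U) (\<lambda>z. - (Y (U, x) \<circ> inv_into U x) z)"
      by (rule smooth_on_bounded_linear[OF chart_open_image[OF M that]
            bounded_linear_minus[OF bounded_linear_ident]])
    then show ?thesis by (simp add: o_def)
  qed
  ultimately show ?thesis
    unfolding smooth_vfields_def by blast
qed

text \<open>A bump function cuts off the coordinate fields of a chart; since its support is compact,
  hence closed in the Hausdorff space of points, extension by zero is smooth.\<close>

lemma coordinate_vfields:
  assumes c: "(U, x) \<in> N" and z0: "z0 \<in> x ` U"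
  obtains T where "open T" and "z0 \<in> T" and "T \<subseteq> x ` U"
    and "\<And>v. \<exists>Y\<in>smooth_vfields N. \<forall>z\<in>T. Y (U, x) (inv_into U x z) = v"
proof -
  obtain B k where cs: "coordinate_system (B :: 'e set) k"
    by (rule model_coordinates)
  obtain r where r: "r > 0" "cball z0 r \<subseteq> x ` U"
    using chart_open_image[OF M c] z0 open_contains_cball by blast
  obtain f :: "'e \<Rightarrow> real" and T where f: "smooth_on UNIV f" "open T" "z0 \<in> T"
      "\<And>z. z \<in> T \<Longrightarrow> f z = 1" "\<And>z. z \<notin> cball z0 r \<Longrightarrow> f z = 0"
    using smooth_bump[OF cs r(1), of z0] by blast
  have "continuous_on (cball z0 r) (inv_into U x)"
    using chart_inv_continuous[OF M c] r(2) by (rule continuous_on_subset)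
  then have closed: "closed (inv_into U x ` cball z0 r)"
    by (intro compact_imp_closed compact_continuous_image compact_cball_finite_dim[OF cs])
  define K where "K = inv_into U x ` cball z0 r"
  have f0: "f (x p) = 0" if "p \<in> U" "p \<notin> K" for p
    using that chart_inv[OF M c that(1)] by (intro f(5)) (force simp: K_def)
  \<comment> \<open>\<open>f\<close> times the field that is constantly \<open>v\<close> in the chart \<open>(U, x)\<close>, seen in the chart \<open>ch\<close>.\<close>
  define Y where "Y v ch p =
      (if p \<in> U then f (x p) *\<^sub>R frechet_derivative (snd ch \<circ> inv_into U x) (at (x p)) v else 0)"
    for v :: 'e and ch :: "('n, 'e) chart" and p
  have trans_diff: "(y \<circ> inv_into V w) differentiable (at (w p))"
    if "(V, w) \<in> N" "(V', y) \<in> N" "p \<in> V" "p \<in> V'" for V w V' y p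
    using smooth_on_differentiable[OF transition_smooth[OF M that(1,2)]] that by blast
  have Y_smooth: "smooth_on (y ` V) (Y v (V, y) \<circ> inv_into V y)" if V: "(V, y) \<in> N" for V y v
  proof -
    have o1: "open (y ` (V \<inter> U))"
      by (intro open_chart_image[OF M V] open_Int chart_open[OF M V] chart_open[OF M c]) auto
    have o2: "open (y ` (V - K))"
      using closed unfolding K_def
      by (intro open_chart_image[OF M V] open_Diff chart_open[OF M V]) auto
    have o3: "open (x ` (U \<inter> V))"
      by (intro open_chart_image[OF M c] open_Int chart_open[OF M V] chart_open[OF M c]) auto
    have tr: "smooth_on (y ` (V \<inter> U)) (x \<circ> inv_into V y)"
      by (rule transition_smooth[OF M V c])
    have "smooth_on (y ` (V \<inter> U)) (\<lambda>z. f ((x \<circ> inv_into V y) z) *\<^sub>R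
        (dir_deriv v (y \<circ> inv_into U x) ((x \<circ> inv_into V y) z)))"
    proof (rule smooth_on_bilinear[OF o1 bounded_bilinear_scaleR])
      show "smooth_on (y ` (V \<inter> U)) (\<lambda>z. f ((x \<circ> inv_into V y) z))"
        by (rule smooth_on_compose[OF cs o1 open_UNIV subset_UNIV f(1) tr])
      have "(x \<circ> inv_into V y) ` y ` (V \<inter> U) \<subseteq> x ` (U \<inter> V)"
        using chart_inv[OF M V] by auto
      then show "smooth_on (y ` (V \<inter> U))
          (\<lambda>z. dir_deriv v (y \<circ> inv_into U x) ((x \<circ> inv_into V y) z))"
        by (rule smooth_on_compose[OF cs o1 o3 _ smooth_on_dir_deriv[OF transition_smooth[OF M c V]] tr])
    qed
    then have s1: "smooth_on (y ` (V \<inter> U)) (Y v (V, y) \<circ> inv_into V y)"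
    proof (rule smooth_on_cong[OF o1, rotated])
      fix z assume "z \<in> y ` (V \<inter> U)"
      then obtain p where "p \<in> V" "p \<in> U" "z = y p" by blast
      then show "f ((x \<circ> inv_into V y) z) *\<^sub>R
        (dir_deriv v (y \<circ> inv_into U x) ((x \<circ> inv_into V y) z)) = (Y v (V, y) \<circ> inv_into V y) z"
        by (simp add: chart_inv[OF M V] Y_def dir_deriv_def)
    qed
      have s2: "smooth_on (y ` (V - K)) (Y v (V, y) \<circ> inv_into V y)"
    proof (rule smooth_on_cong[OF o2])
      fix z assume "z \<in> y ` (V - K)"
      then obtain p where "p \<in> V" "p \<notin> K" "z = y p" by blast
      then show "0 = (Y v (V, y) \<circ> inv_into V y) z"
        using f0 by (simp add: chart_inv[OF M V] Y_def)
    qed (rule smooth_on_const)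
    have "K \<subseteq> U"
      using r(2) chart_inv_in[OF M c] by (auto simp: K_def)
    then have "y ` V = y ` (V \<inter> U) \<union> y ` (V - K)" by blast
    then show ?thesis using smooth_on_Un[OF s1 s2] by simp
  qed
  have Y_trans: "Y v (V', y) p = frechet_derivative (y \<circ> inv_into V w) (at (w p)) (Y v (V, w) p)"
    if V: "(V, w) \<in> N" "(V', y) \<in> N" "p \<in> V" "p \<in> V'" for V w V' y v p
  proof -
    have lin: "linear (frechet_derivative (y \<circ> inv_into V w) (at (w p)))"
      by (intro linear_frechet_derivative trans_diff[OF V])
    show ?thesis
    proof (cases "p \<in> U")
      case True
      then show ?thesis
        using chart_change_derivative[OF c V(1), of p y v] trans_diff[OF V] V(3)
        by (simp add: Y_def linear_scale[OF lin])
    qed (simp add: Y_def linear_0[OF lin])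
  qed
  have Y: "Y v \<in> smooth_vfields N" for v
    unfolding smooth_vfields_def using Y_smooth Y_trans by blast
  show thesis
  proof
    show "open (T \<inter> x ` U)" "z0 \<in> T \<inter> x ` U" "T \<inter> x ` U \<subseteq> x ` U"
      using f(2,3) z0 chart_open_image[OF M c] by auto
    fix v
    have "Y v (U, x) (inv_into U x z) = v" if z: "z \<in> T \<inter> x ` U" for z
    proof -
      have zU: "z \<in> x ` U" using z by blast
      have "frechet_derivative (x \<circ> inv_into U x) (at z) = frechet_derivative id (at z)"
        by (rule frechet_derivative_cong_open[OF chart_open_image[OF M c] _ zU])
           (simp add: chart_inv_right[OF M c])
      then show ?thesis
        using z f(4) by (simp add: Y_def chart_inv_in[OF M c zU] chart_inv_right[OF M c zU])
    qed
    then show "\<exists>Y\<in>smooth_vfields N. \<forall>z\<in>T \<inter> x ` U. Y (U, x) (inv_into U x z) = v"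
      using Y by blast
  qed
qed

end


section \<open>Derivations along vector fields as limits of difference quotients\<close>

lemma difference_quotient_norm:
  fixes a w :: "'a::real_normed_vector"
  assumes "t \<noteq> 0" shows "norm (a - t *\<^sub>R w) / norm t = norm (a /\<^sub>R t - w)"
proof -
  have eq: "a - t *\<^sub>R w = t *\<^sub>R (a /\<^sub>R t - w)"
    using assms by (simp add: scaleR_diff_right)
  have "norm (a - t *\<^sub>R w) = norm t * norm (a /\<^sub>R t - w)"
    unfolding eq norm_scaleR using assms by simp
  then show ?thesis using assms by simp
qed

text \<open>This sequence approaches \<open>p\<close> with velocity \<open>Y\<close>. Since it does not depend on the map that is
  differentiated, limits of difference quotients of several maps along it can be multiplied,
  which yields product rules for derivatives along \<open>Y\<close>. The chart is the one used in
  \<^const>\<open>vfield_apply\<close>.\<close>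

definition approach_seq ::
  "('n, 'e::real_normed_vector) atlas \<Rightarrow> ('n, 'e) vfield \<Rightarrow> 'n \<Rightarrow> nat \<Rightarrow> 'n"
  where "approach_seq N Y p n =
    (let (U, x) = (SOME c. c \<in> N \<and> p \<in> fst c)
     in inv_into U x (x p + inverse (real (Suc n)) *\<^sub>R Y (U, x) p))"

context
  fixes N :: "('n::{t2_space, second_countable_topology}, 'e::real_normed_vector) atlas"
  assumes M: "smooth_manifold N"
begin

lemma some_chart:
  obtains U x where "(SOME c. c \<in> N \<and> p \<in> fst c) = (U, x)" and "(U, x) \<in> N" and "p \<in> U"
proof -
  obtain V y where V: "(V, y) \<in> N" "p \<in> V" using chart_exists[OF M] by blast
  have "(SOME c. c \<in> N \<and> p \<in> fst c) \<in> N \<and> p \<in> fst (SOME c. c \<in> N \<and> p \<in> fst c)"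
    by (rule someI[of "\<lambda>c. c \<in> N \<and> p \<in> fst c" "(V, y)"]) (use V in simp)
  then show thesis
    by (cases "SOME c. c \<in> N \<and> p \<in> fst c") (use that in auto)
qed

lemma approach_line: "(\<lambda>n. z0 + inverse (real (Suc n)) *\<^sub>R v) \<longlonglongrightarrow> (z0 :: 'e)"
proof -
  have "(\<lambda>n. z0 + inverse (real (Suc n)) *\<^sub>R v) \<longlonglongrightarrow> z0 + 0 *\<^sub>R v"
    by (intro tendsto_intros LIMSEQ_inverse_real_of_nat)
  then show ?thesis by simp
qed

lemma approach_seq_tendsto: "approach_seq N Y p \<longlonglongrightarrow> p"
proof -
  obtain U x where c: "(SOME c. c \<in> N \<and> p \<in> fst c) = (U, x)" "(U, x) \<in> N" "p \<in> U"
    by (rule some_chart)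
  have "isCont (inv_into U x) (x p)"
    using chart_inv_continuous[OF M c(2)] c(3)
    by (simp add: continuous_on_eq_continuous_at[OF chart_open_image[OF M c(2)]])
  from isCont_tendsto_compose[OF this approach_line] show ?thesis
    by (simp add: approach_seq_def[abs_def] c(1) chart_inv[OF M c(2,3)])
qed

lemma approach_seq_quotient:
  assumes "\<phi> \<in> smooth_maps N"
  shows "(\<lambda>n. real (Suc n) *\<^sub>R (\<phi> (approach_seq N Y p n) - \<phi> p)) \<longlonglongrightarrow> vfield_apply N Y \<phi> p"
proof -
  obtain U x where c: "(SOME c. c \<in> N \<and> p \<in> fst c) = (U, x)" "(U, x) \<in> N" "p \<in> U"
    by (rule some_chart)
  define f where "f = \<phi> \<circ> inv_into U x"
  define v where "v = Y (U, x) p"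
  define D where "D = frechet_derivative f (at (x p))"
  have D: "(f has_derivative D) (at (x p))"
    using smooth_on_differentiable[OF smooth_mapsD[OF assms c(2)]] c(3)
    unfolding f_def D_def by (simp add: frechet_derivative_works)
  interpret D: bounded_linear D using D by (rule has_derivative_bounded_linear)
  have "((\<lambda>t. f (x p + t *\<^sub>R v)) has_derivative (\<lambda>t. D (t *\<^sub>R v))) (at 0)"
  proof (rule has_derivative_compose[where g = f and f = "\<lambda>t. x p + t *\<^sub>R v", THEN has_derivative_eq_rhs])
    show "((\<lambda>t. x p + t *\<^sub>R v) has_derivative (\<lambda>t. t *\<^sub>R v)) (at 0)"
      by (auto intro!: derivative_eq_intros)
    show "(f has_derivative D) (at (x p + 0 *\<^sub>R v))" using D by simp
  qed simp
  then have lim: "((\<lambda>t. norm (f (x p + t *\<^sub>R v) - f (x p) - t *\<^sub>R D v) / norm t) \<longlongrightarrow> 0) (at 0)"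
    unfolding has_derivative_at by (simp only: D.scaleR add_0_left scaleR_zero_left add_0_right)
  have "((\<lambda>t. norm ((f (x p + t *\<^sub>R v) - f (x p)) /\<^sub>R t - D v)) \<longlongrightarrow> 0) (at 0)"
  proof (rule Lim_transform_eventually[OF lim])
    show "\<forall>\<^sub>F t in at 0. norm (f (x p + t *\<^sub>R v) - f (x p) - t *\<^sub>R D v) / norm t
        = norm ((f (x p + t *\<^sub>R v) - f (x p)) /\<^sub>R t - D v)"
      unfolding eventually_at_filter by (intro always_eventually allI impI difference_quotient_norm)
  qed
  then have "((\<lambda>t. (f (x p + t *\<^sub>R v) - f (x p)) /\<^sub>R t) \<longlongrightarrow> D v) (at 0)"
    by (rule LIM_zero_cancel[OF tendsto_norm_zero_cancel])
  moreover have "filterlim (\<lambda>n. inverse (real (Suc n))) (at 0) sequentially"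
    using LIMSEQ_inverse_real_of_nat by (auto simp: filterlim_at)
  ultimately have "(\<lambda>n. (f (x p + inverse (real (Suc n)) *\<^sub>R v) - f (x p)) /\<^sub>R inverse (real (Suc n)))
      \<longlonglongrightarrow> D v"
    by (rule filterlim_compose)
  then show ?thesis
    by (simp add: approach_seq_def vfield_apply_def c(1) f_def v_def D_def chart_inv[OF M c(2,3)]
        del: of_nat_Suc)
qed

lemma smooth_maps_tendsto:
  assumes "\<phi> \<in> smooth_maps N" and "q \<longlonglongrightarrow> p"
  shows "(\<lambda>n. \<phi> (q n)) \<longlonglongrightarrow> \<phi> p"
  using smooth_maps_continuous[OF M assms(1)] assms(2)
  by (simp add: continuous_on_eq_continuous_at isCont_tendsto_compose)

lemma vfield_apply_bounded_linear:
  assumes "bounded_linear L" and "\<phi> \<in> smooth_maps N"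
  shows "vfield_apply N Y (\<lambda>p. L (\<phi> p)) p = L (vfield_apply N Y \<phi> p)"
proof (rule LIMSEQ_unique)
  interpret L: bounded_linear L by (rule assms(1))
  show "(\<lambda>n. real (Suc n) *\<^sub>R (L (\<phi> (approach_seq N Y p n)) - L (\<phi> p)))
      \<longlonglongrightarrow> vfield_apply N Y (\<lambda>p. L (\<phi> p)) p"
    by (rule approach_seq_quotient[OF smooth_maps_bounded_linear[OF M assms]])
  show "(\<lambda>n. real (Suc n) *\<^sub>R (L (\<phi> (approach_seq N Y p n)) - L (\<phi> p)))
      \<longlonglongrightarrow> L (vfield_apply N Y \<phi> p)"
    using L.tendsto[OF approach_seq_quotient[OF assms(2), of Y p]]
    by (simp only: L.scaleR L.diff)
qed

lemma vfield_apply_minus_field: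
  assumes "Y \<in> smooth_vfields N" and "\<phi> \<in> smooth_maps N"
  shows "vfield_apply N (\<lambda>c p. - Y c p) \<phi> p = - vfield_apply N Y \<phi> p"
proof -
  obtain U x where c: "(U, x) \<in> N" "p \<in> U" using chart_exists[OF M] by blast
  have "linear (frechet_derivative (\<phi> \<circ> inv_into U x) (at (x p)))"
    using c smooth_on_differentiable[OF smooth_mapsD[OF assms(2) c(1)]]
    by (intro linear_frechet_derivative) blast
  then show ?thesis
    by (simp add: vfield_apply_chart[OF M minus_vfield[OF M assms(1)] assms(2) c]
        vfield_apply_chart[OF M assms c] linear_neg)
qed

lemma vfield_apply_zero_field:
  assumes "\<phi> \<in> smooth_maps N"
  shows "vfield_apply N (\<lambda>_ _. 0) \<phi> p = 0"
proof -
  obtain U x where c: "(U, x) \<in> N" "p \<in> U" using chart_exists[OF M] by blast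
  have "linear (frechet_derivative (\<phi> \<circ> inv_into U x) (at (x p)))"
    using c smooth_on_differentiable[OF smooth_mapsD[OF assms c(1)]]
    by (intro linear_frechet_derivative) blast
  then show ?thesis
    by (simp add: vfield_apply_chart[OF M zero_vfield[OF M] assms c] linear_0)
qed

text \<open>Both sides are derivatives of the same function, computed by the product rule.\<close>

lemma vfield_cinner_product_rule:
  fixes \<psi> f :: "'n \<Rightarrow> 'b::complex_hilbert_space" and \<theta> g :: "'n \<Rightarrow> 'a::complex_hilbert_space"
  assumes "\<psi> \<in> smooth_maps N" "f \<in> smooth_maps N" "\<theta> \<in> smooth_maps N" "g \<in> smooth_maps N"
    and eq: "\<And>p. cinner (\<psi> p) (f p) = cinner (\<theta> p) (g p)"
  shows "cinner (\<psi> p) (vfield_apply N Y f p) + cinner (vfield_apply N Y \<psi> p) (f p) =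
    cinner (\<theta> p) (vfield_apply N Y g p) + cinner (vfield_apply N Y \<theta> p) (g p)"
proof -
  let ?q = "approach_seq N Y p"
  have lim: "(\<lambda>n. real (Suc n) *\<^sub>R (cinner (u (?q n)) (w (?q n)) - cinner (u p) (w p)))
      \<longlonglongrightarrow> cinner (u p) (vfield_apply N Y w p) + cinner (vfield_apply N Y u p) (w p)"
    if uw: "u \<in> smooth_maps N" "w \<in> smooth_maps N"
    for u w :: "'n \<Rightarrow> 'c::complex_hilbert_space"
  proof -
    interpret bounded_bilinear "cinner :: 'c \<Rightarrow> 'c \<Rightarrow> complex" by (rule bounded_bilinear_cinner)
    have "(\<lambda>n. cinner (u (?q n)) (real (Suc n) *\<^sub>R (w (?q n) - w p))
        + cinner (real (Suc n) *\<^sub>R (u (?q n) - u p)) (w p))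
      \<longlonglongrightarrow> cinner (u p) (vfield_apply N Y w p) + cinner (vfield_apply N Y u p) (w p)"
      by (intro tendsto_add tendsto approach_seq_quotient uw tendsto_const
          smooth_maps_tendsto[OF uw(1) approach_seq_tendsto])
    moreover have "cinner u1 (r *\<^sub>R (w1 - w0)) + cinner (r *\<^sub>R (u1 - u0)) w0
        = r *\<^sub>R (cinner u1 w1 - cinner u0 w0)" for u1 u0 w1 w0 :: 'c and r
      by (simp add: scaleR_left scaleR_right diff_left diff_right flip: scaleR_right_distrib)
    ultimately show ?thesis by (simp only:)
  qed
  show ?thesis
    using LIMSEQ_unique[OF lim[OF assms(1,2)]] lim[OF assms(3,4)] by (simp add: eq)
qed

text \<open>The complex conjugate vector field: the inner product is antilinear in its first argument,
  so a derivative along \<open>X\<close> moves to that argument as a derivative along this field.\<close>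

definition conj_field :: "('n, 'e) cvfield \<Rightarrow> ('n, 'e) cvfield"
  where "conj_field X = (fst X, \<lambda>c p. - snd X c p)"

lemma conj_field_Vect: "X \<in> Vect N \<Longrightarrow> conj_field X \<in> Vect N"
  by (auto simp: Vect_def conj_field_def minus_vfield[OF M])

lemma cvfield_cinner_product_rule:
  fixes \<psi> f :: "'n \<Rightarrow> 'b::complex_hilbert_space" and \<theta> g :: "'n \<Rightarrow> 'a::complex_hilbert_space"
  assumes "X \<in> Vect N"
    and sm: "\<psi> \<in> smooth_maps N" "f \<in> smooth_maps N" "\<theta> \<in> smooth_maps N" "g \<in> smooth_maps N"
    and eq: "\<And>p. cinner (\<psi> p) (f p) = cinner (\<theta> p) (g p)"
  shows "cinner (\<psi> p) (cvfield_apply N X f p) + cinner (cvfield_apply N (conj_field X) \<psi> p) (f p) =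
    cinner (\<theta> p) (cvfield_apply N X g p) + cinner (cvfield_apply N (conj_field X) \<theta> p) (g p)"
proof -
  have X: "fst X \<in> smooth_vfields N" "snd X \<in> smooth_vfields N"
    using assms(1) by (auto simp: Vect_def)
  have expand: "cinner (u p) (cvfield_apply N X w p) + cinner (cvfield_apply N (conj_field X) u p) (w p)
      = (cinner (u p) (vfield_apply N (fst X) w p) + cinner (vfield_apply N (fst X) u p) (w p))
      + \<i> * (cinner (u p) (vfield_apply N (snd X) w p) + cinner (vfield_apply N (snd X) u p) (w p))"
    if "u \<in> smooth_maps N" for u w :: "'n \<Rightarrow> 'c::complex_hilbert_space"
    using that
    by (simp add: cvfield_apply_def conj_field_def vfield_apply_minus_field[OF X(2)]
        cinner_add_left cinner_add_right cinner_scaleC_left cinner_scaleC_right cinner_minus_left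
        algebra_simps)
  show ?thesis
    unfolding expand[OF sm(1)] expand[OF sm(3)] vfield_cinner_product_rule[OF sm eq] ..
qed

lemma cvfield_apply_scaleC:
  assumes "\<phi> \<in> smooth_maps N"
  shows "cvfield_apply N X (\<lambda>p. a *\<^sub>C \<phi> p) p = a *\<^sub>C cvfield_apply N X \<phi> p"
  by (simp add: cvfield_apply_def vfield_apply_bounded_linear[OF bounded_linear_scaleC assms]
      scaleC_add_right scaleC_scaleC mult.commute)

lemma cvfield_apply_real:
  "\<phi> \<in> smooth_maps N \<Longrightarrow> cvfield_apply N (Y, \<lambda>_ _. 0) \<phi> p = vfield_apply N Y \<phi> p"
  by (simp add: cvfield_apply_def vfield_apply_zero_field)

end

section \<open>Approximation by a dense submodule\<close>

text \<open>The conditions for finitely many lists \<open>vs\<close> define an open neighbourhood of \<open>\<phi>0\<close> in the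
  Frechet topology.\<close>

lemma dense_submodule_approx:
  assumes \<Gamma>: "dense_smooth_submodule N \<Gamma>" and "(U, x) \<in> N" and "compact K" and "K \<subseteq> U"
    and "finite Vs" and "\<phi>0 \<in> smooth_maps N" and "\<epsilon> > 0"
  obtains \<phi> where "\<phi> \<in> \<Gamma>" and "\<And>vs p. vs \<in> Vs \<Longrightarrow> p \<in> K \<Longrightarrow>
    norm (foldr dir_deriv vs (\<phi> \<circ> inv_into U x) (x p)
      - foldr dir_deriv vs (\<phi>0 \<circ> inv_into U x) (x p)) < \<epsilon>"
proof -
  define G where "G vs = {\<psi> \<in> smooth_maps N. \<forall>p\<in>K.
      norm (foldr dir_deriv vs (\<psi> \<circ> inv_into U x) (x p)
        - foldr dir_deriv vs (\<phi>0 \<circ> inv_into U x) (x p)) < \<epsilon>}" for vs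
  have open_G: "openin (smooth_topology N) (G vs)" for vs
    unfolding smooth_topology_def
    by (rule topology_generated_by_Basis, unfold G_def mem_Collect_eq)
       (rule exI[of _ \<phi>0], rule exI[of _ U], rule exI[of _ x], rule exI[of _ K],
        rule exI[of _ vs], rule exI[of _ \<epsilon>], simp add: assms)
  have "openin (smooth_topology N) (\<Inter>vs\<in>insert [] Vs. G vs)"
    using \<open>finite Vs\<close> open_G by (intro openin_INT2) auto
  moreover have "\<phi>0 \<in> (\<Inter>vs\<in>insert [] Vs. G vs)"
    using assms by (simp add: G_def)
  moreover have "\<phi>0 \<in> smooth_topology N closure_of \<Gamma>"
    using \<Gamma> assms(6) unfolding dense_smooth_submodule_def by blast
  ultimately obtain \<phi> where "\<phi> \<in> \<Gamma>" "\<phi> \<in> (\<Inter>vs\<in>insert [] Vs. G vs)"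
    unfolding in_closure_of by blast
  then show thesis
    by (intro that[of \<phi>]) (auto simp: G_def)
qed

lemma dense_submodule_values:
  fixes \<Gamma> :: "('n::{t2_space, second_countable_topology} \<Rightarrow> 'h::complex_hilbert_space) set"
  assumes "smooth_manifold N" and "dense_smooth_submodule N \<Gamma>"
  shows "closure {\<phi> p | \<phi>. \<phi> \<in> \<Gamma>} = UNIV"
proof -
  have "h \<in> closure {\<phi> p | \<phi>. \<phi> \<in> \<Gamma>}" for h
    unfolding closure_approachable
  proof (intro allI impI)
    fix e :: real assume e: "e > 0"
    obtain U x where c: "(U, x) \<in> N" "p \<in> U" using chart_exists[OF assms(1)] by blast
    obtain \<phi> where "\<phi> \<in> \<Gamma>" "\<And>vs q. vs \<in> {[]} \<Longrightarrow> q \<in> {p} \<Longrightarrow>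
        norm (foldr dir_deriv vs (\<phi> \<circ> inv_into U x) (x q)
          - foldr dir_deriv vs ((\<lambda>_. h) \<circ> inv_into U x) (x q)) < e"
      by (rule dense_submodule_approx[OF assms(2) c(1), of "{p}" "{[]}" "\<lambda>_. h" e])
         (use c e smooth_maps_const[OF assms(1)] in auto)
    then have "\<phi> \<in> \<Gamma>" "dist (\<phi> p) h < e"
      using chart_inv[OF assms(1) c] by (auto simp: dist_norm)
    then show "\<exists>y\<in>{\<phi> p | \<phi>. \<phi> \<in> \<Gamma>}. dist y h < e" by blast
  qed
  then show ?thesis by blast
qed


section \<open>Adjoints of bounded operators\<close>

lemma adjoint_value_bound:
  fixes g :: "'a::complex_hilbert_space" and k :: "'b::complex_hilbert_space"
  assumes "\<And>h. cinner k (T h) = cinner g h" and "\<And>h. norm (T h) \<le> C * norm h" and "C \<ge> 0"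
  shows "norm g \<le> C * norm k"
proof (cases "g = 0")
  case False
  have "of_real ((norm g)\<^sup>2) = cinner k (T g)"
    by (simp only: assms(1) cinner_self)
  then have "(norm g)\<^sup>2 = cmod (cinner k (T g))"
    by (metis abs_of_nonneg norm_of_real zero_le_power2)
  also have "\<dots> \<le> norm k * (C * norm g)"
    by (rule order_trans[OF complex_Cauchy_Schwarz mult_left_mono[OF assms(2) norm_ge_zero]])
  finally have "norm g * norm g \<le> (C * norm k) * norm g"
    by (simp add: power2_eq_square mult_ac)
  then show ?thesis
    using False by simp
qed (use assms(3) in simp)

lemma adjoint_diff:
  fixes g g' :: "'a::complex_hilbert_space" and k k' :: "'b::complex_hilbert_space"
  assumes "\<And>h. cinner k (T h) = cinner g h" and "\<And>h. cinner k' (T h) = cinner g' h"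
    and "\<And>h. norm (T h) \<le> C * norm h" and "C \<ge> 0"
  shows "norm (g - g') \<le> C * norm (k - k')"
  by (rule adjoint_value_bound[OF _ assms(3,4)]) (simp add: cinner_diff_left assms(1,2))

lemma cinner_left_eqD:
  fixes g g' :: "'a::complex_hilbert_space"
  assumes "\<And>h. cinner g h = cinner g' h"
  shows "g = g'"
proof -
  have "cinner (g - g') (g - g') = 0" by (simp add: cinner_diff_left assms)
  then show ?thesis by (simp add: cinner_self)
qed

lemma tendsto_cinner_left:
  fixes g :: "'a::complex_hilbert_space"
  shows "u \<longlonglongrightarrow> g \<Longrightarrow> (\<lambda>n. cinner (u n) h) \<longlonglongrightarrow> cinner g h"
  by (rule bounded_bilinear.tendsto[OF bounded_bilinear_cinner]) (rule tendsto_const | assumption)+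

text \<open>The vectors at which the adjoint is defined form a closed set, since the adjoint is
  bounded where it is defined. Together with density this replaces the Riesz
  representation theorem.\<close>

lemma adjoint_exists_from_dense:
  fixes T :: "'a::complex_hilbert_space \<Rightarrow> 'b::complex_hilbert_space"
  assumes T: "bounded_linear T" and D: "closure D = UNIV"
    and adj: "\<And>k. k \<in> D \<Longrightarrow> \<exists>g. \<forall>h. cinner k (T h) = cinner g h"
  shows "\<exists>g. \<forall>h. cinner k (T h) = cinner g h"
proof -
  obtain C where C: "C > 0" "\<And>h. norm (T h) \<le> norm h * C"
    using bounded_linear.pos_bounded[OF T] by blast
  have bound: "norm (T h) \<le> C * norm h" for h
    using C(2)[of h] by (simp add: mult.commute)
  have "k \<in> closure D" using D by simp
  then obtain u where u: "\<And>n. u n \<in> D" "u \<longlonglongrightarrow> k"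
    unfolding closure_sequential by blast
  define g where "g n = (SOME g. \<forall>h. cinner (u n) (T h) = cinner g h)" for n :: nat
  have g: "cinner (u n) (T h) = cinner (g n) h" for n h
    using someI_ex[OF adj[OF u(1)[of n]]] unfolding g_def by blast
  have "Cauchy g"
  proof (rule metric_CauchyI)
    fix e :: real assume "e > 0"
    then have "e / C > 0" using C(1) by simp
    then obtain n0 where n0: "\<And>m n. m \<ge> n0 \<Longrightarrow> n \<ge> n0 \<Longrightarrow> dist (u m) (u n) < e / C"
      using metric_CauchyD[OF LIMSEQ_imp_Cauchy[OF u(2)]] by blast
    have "dist (g m) (g n) < e" if "m \<ge> n0" "n \<ge> n0" for m n
    proof -
      have "dist (g m) (g n) \<le> C * dist (u m) (u n)"
        unfolding dist_norm using C(1) by (intro adjoint_diff[OF g g bound]) simp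
      also have "\<dots> < e"
        using n0[OF that] C(1) by (simp add: field_simps)
      finally show ?thesis .
    qed
    then show "\<exists>M. \<forall>m\<ge>M. \<forall>n\<ge>M. dist (g m) (g n) < e" by blast
  qed
  then obtain g0 where "g \<longlonglongrightarrow> g0"
    by (meson Cauchy_convergent convergentD)
  have "cinner k (T h) = cinner g0 h" for h
  proof (rule LIMSEQ_unique)
    show "(\<lambda>n. cinner (u n) (T h)) \<longlonglongrightarrow> cinner k (T h)"
      by (rule tendsto_cinner_left[OF u(2)])
    show "(\<lambda>n. cinner (u n) (T h)) \<longlonglongrightarrow> cinner g0 h"
      unfolding g by (rule tendsto_cinner_left[OF \<open>g \<longlonglongrightarrow> g0\<close>])
  qed
  then show ?thesis by blast
qed

lemma adjoint_op_everywhere: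
  assumes "\<And>h. cinner k (T h) = cinner g h"
  shows "adjoint_op (everywhere_defined T) k = Some g"
proof -
  have "(THE g'. \<forall>h. cinner k (T h) = cinner g' h) = g"
  proof (rule the_equality)
    show "\<forall>h. cinner k (T h) = cinner g h" using assms by blast
    show "g' = g" if "\<forall>h. cinner k (T h) = cinner g' h" for g'
      by (rule cinner_left_eqD) (use that assms in simp)
  qed
  moreover have "\<exists>g. \<forall>h. cinner k (T h) = cinner g h" using assms by blast
  moreover have "dom (everywhere_defined T) = UNIV" by (auto simp: everywhere_defined_def)
  ultimately show ?thesis
    by (simp add: adjoint_op_def everywhere_defined_def)
qed


section \<open>Smooth fields of bounded operators\<close>

locale dense_smooth_submodules =
  fixes N :: "('n::{t2_space, second_countable_topology}, 'e::real_normed_vector) atlas"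
    and \<Gamma>1 :: "('n \<Rightarrow> 'a::complex_hilbert_space) set"
    and \<Gamma>2 :: "('n \<Rightarrow> 'b::complex_hilbert_space) set"
  assumes M: "smooth_manifold N"
    and \<Gamma>1: "dense_smooth_submodule N \<Gamma>1" and \<Gamma>2: "dense_smooth_submodule N \<Gamma>2"
begin

text \<open>Here \<open>\<theta>\<close> is the adjoint field applied to \<open>\<psi>\<close>. It is characterised through inner products,
  so that the relation can be differentiated and extended by continuity.\<close>

definition smooth_bounded_field :: "('n \<Rightarrow> 'a \<Rightarrow> 'b) \<Rightarrow> bool"
  where "smooth_bounded_field B \<longleftrightarrow>
    (\<forall>p. bounded_clinear (B p)) \<and>
    (\<forall>\<phi>\<in>\<Gamma>1. (\<lambda>p. B p (\<phi> p)) \<in> smooth_maps N) \<and>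
    (\<forall>\<psi>\<in>\<Gamma>2. \<exists>\<theta>\<in>smooth_maps N. \<forall>p h. cinner (\<psi> p) (B p h) = cinner (\<theta> p) h)"

text \<open>The value at \<open>p\<close> of the derivative of the field \<open>B\<close> along \<open>X\<close>, applied to \<open>\<phi>\<close>.\<close>

definition field_commutator ::
  "('n, 'e) cvfield \<Rightarrow> ('n \<Rightarrow> 'a \<Rightarrow> 'b) \<Rightarrow> ('n \<Rightarrow> 'a) \<Rightarrow> 'n \<Rightarrow> 'b"
  where "field_commutator X B \<phi> p =
    cvfield_apply N X (\<lambda>q. B q (\<phi> q)) p - B p (cvfield_apply N X \<phi> p)"

definition strongly_continuous :: "('n \<Rightarrow> 'a \<Rightarrow> 'b) \<Rightarrow> bool"
  where "strongly_continuous B \<longleftrightarrow> (\<forall>h. continuous_on UNIV (\<lambda>p. B p h))"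

lemma smooth_bounded_fieldD:
  assumes "smooth_bounded_field B"
  shows "bounded_clinear (B p)" and "bounded_linear (B p)"
    and "\<phi> \<in> \<Gamma>1 \<Longrightarrow> (\<lambda>p. B p (\<phi> p)) \<in> smooth_maps N"
    and "\<psi> \<in> \<Gamma>2 \<Longrightarrow> \<exists>\<theta>\<in>smooth_maps N. \<forall>p h. cinner (\<psi> p) (B p h) = cinner (\<theta> p) h"
  using assms unfolding smooth_bounded_field_def bounded_clinear_def by blast+

lemma \<Gamma>1D: "\<phi> \<in> \<Gamma>1 \<Longrightarrow> \<phi> \<in> smooth_maps N"
    "X \<in> Vect N \<Longrightarrow> \<phi> \<in> \<Gamma>1 \<Longrightarrow> cvfield_apply N X \<phi> \<in> \<Gamma>1"
  using \<Gamma>1 unfolding dense_smooth_submodule_def by blast+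

lemma \<Gamma>2D: "\<psi> \<in> \<Gamma>2 \<Longrightarrow> \<psi> \<in> smooth_maps N"
    "X \<in> Vect N \<Longrightarrow> \<psi> \<in> \<Gamma>2 \<Longrightarrow> cvfield_apply N X \<psi> \<in> \<Gamma>2"
  using \<Gamma>2 unfolding dense_smooth_submodule_def by blast+

lemma field_commutator_smooth:
  assumes "smooth_bounded_field B" and "X \<in> Vect N" and "\<phi> \<in> \<Gamma>1"
  shows "field_commutator X B \<phi> \<in> smooth_maps N"
proof -
  have "(\<lambda>p. cvfield_apply N X (\<lambda>q. B q (\<phi> q)) p - B p (cvfield_apply N X \<phi> p)) \<in> smooth_maps N"
    by (intro smooth_maps_diff[OF M] cvfield_apply_smooth[OF M assms(2)]
        smooth_bounded_fieldD(3)[OF assms(1)] \<Gamma>1D(2)[OF assms(2)] assms(3))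
  then show ?thesis by (simp only: field_commutator_def[abs_def])
qed

text \<open>The adjoint of the commutator of \<open>X\<close> with \<open>B\<close> is the commutator of the conjugate field
  with the adjoint of \<open>B\<close>, by the product rule for inner products.\<close>

lemma field_commutator_adjoint:
  assumes B: "smooth_bounded_field B" and X: "X \<in> Vect N" and \<psi>: "\<psi> \<in> \<Gamma>2"
  shows "\<exists>\<theta>\<in>smooth_maps N. \<forall>\<phi>\<in>\<Gamma>1. \<forall>p.
    cinner (\<psi> p) (field_commutator X B \<phi> p) = cinner (\<theta> p) (\<phi> p)"
proof -
  obtain \<theta> where \<theta>: "\<theta> \<in> smooth_maps N" "\<And>p h. cinner (\<psi> p) (B p h) = cinner (\<theta> p) h"
    using smooth_bounded_fieldD(4)[OF B \<psi>] by blast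
  obtain \<theta>' where \<theta>': "\<theta>' \<in> smooth_maps N"
      "\<And>p h. cinner (cvfield_apply N (conj_field X) \<psi> p) (B p h) = cinner (\<theta>' p) h"
    using smooth_bounded_fieldD(4)[OF B \<Gamma>2D(2)[OF conj_field_Vect[OF M X] \<psi>]] by blast
  have "cinner (\<psi> p) (field_commutator X B \<phi> p)
      = cinner (cvfield_apply N (conj_field X) \<theta> p - \<theta>' p) (\<phi> p)" if \<phi>: "\<phi> \<in> \<Gamma>1" for \<phi> p
  proof -
    have "cinner (\<psi> p) (cvfield_apply N X (\<lambda>q. B q (\<phi> q)) p)
        + cinner (cvfield_apply N (conj_field X) \<psi> p) (B p (\<phi> p))
        = cinner (\<theta> p) (cvfield_apply N X \<phi> p) + cinner (cvfield_apply N (conj_field X) \<theta> p) (\<phi> p)"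
      by (rule cvfield_cinner_product_rule[OF M X \<Gamma>2D(1)[OF \<psi>] smooth_bounded_fieldD(3)[OF B \<phi>]
            \<theta>(1) \<Gamma>1D(1)[OF \<phi>] \<theta>(2)])
    then show ?thesis
      by (simp add: field_commutator_def cinner_diff_right cinner_diff_left \<theta>(2) \<theta>'(2)
          algebra_simps)
  qed
  moreover have "(\<lambda>p. cvfield_apply N (conj_field X) \<theta> p - \<theta>' p) \<in> smooth_maps N"
    by (intro smooth_maps_diff[OF M] cvfield_apply_smooth[OF M conj_field_Vect[OF M X]] \<theta>(1) \<theta>'(1))
  ultimately show ?thesis by (intro bexI[of _ "\<lambda>p. cvfield_apply N (conj_field X) \<theta> p - \<theta>' p"]) auto
qed

text \<open>By the adjoint relation, the inner products of the commutator with the values \<open>\<psi> p\<close>, which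
  are dense, involve only \<open>\<phi> p\<close>.\<close>

lemma field_commutator_pointwise:
  assumes B: "smooth_bounded_field B" and X: "X \<in> Vect N"
    and \<phi>: "\<phi> \<in> \<Gamma>1" "\<phi>' \<in> \<Gamma>1" "\<phi> p = \<phi>' p"
  shows "field_commutator X B \<phi> p = field_commutator X B \<phi>' p"
proof (rule cinner_dense_eqI[OF dense_submodule_values[OF M \<Gamma>2, of p]])
  fix d assume "d \<in> {\<psi> p | \<psi>. \<psi> \<in> \<Gamma>2}"
  then obtain \<psi> where \<psi>: "\<psi> \<in> \<Gamma>2" "d = \<psi> p" by blast
  obtain \<theta> where "\<forall>\<phi>\<in>\<Gamma>1. \<forall>p. cinner (\<psi> p) (field_commutator X B \<phi> p) = cinner (\<theta> p) (\<phi> p)"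
    using field_commutator_adjoint[OF B X \<psi>(1)] by blast
  then show "cinner d (field_commutator X B \<phi> p) = cinner d (field_commutator X B \<phi>' p)"
    using \<phi> \<psi>(2) by simp
qed

lemma field_deriv_eq_commutator:
  assumes B: "smooth_bounded_field B" and X: "X \<in> Vect N" and \<phi>: "\<phi> \<in> \<Gamma>1"
    and F: "\<And>\<phi> p. \<phi> \<in> \<Gamma>1 \<Longrightarrow> F p (\<phi> p) = Some (B p (\<phi> p))"
  shows "field_deriv N \<Gamma>1 X F p (\<phi> p) = Some (field_commutator X B \<phi> p)"
proof -
  have FB: "field_apply F \<phi> = (\<lambda>p. B p (\<phi> p))" if "\<phi> \<in> \<Gamma>1" for \<phi>
    unfolding field_apply_def using F[OF that] by simp
  have comm: "cvfield_apply N X (field_apply F \<phi>') p - field_apply F (cvfield_apply N X \<phi>') p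
      = field_commutator X B \<phi>' p" if "\<phi>' \<in> \<Gamma>1" for \<phi>'
    unfolding FB[OF that] FB[OF \<Gamma>1D(2)[OF X that]] field_commutator_def ..
  have "(THE k. \<forall>\<phi>'\<in>\<Gamma>1. \<phi>' p = \<phi> p \<longrightarrow>
      k = cvfield_apply N X (field_apply F \<phi>') p - field_apply F (cvfield_apply N X \<phi>') p)
    = field_commutator X B \<phi> p"
  proof (rule the_equality)
    show "\<forall>\<phi>'\<in>\<Gamma>1. \<phi>' p = \<phi> p \<longrightarrow> field_commutator X B \<phi> p =
        cvfield_apply N X (field_apply F \<phi>') p - field_apply F (cvfield_apply N X \<phi>') p"
    proof (intro ballI impI)
      fix \<phi>' assume "\<phi>' \<in> \<Gamma>1" "\<phi>' p = \<phi> p"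
      then show "field_commutator X B \<phi> p =
        cvfield_apply N X (field_apply F \<phi>') p - field_apply F (cvfield_apply N X \<phi>') p"
        unfolding comm[OF \<open>\<phi>' \<in> \<Gamma>1\<close>] by (intro field_commutator_pointwise[OF B X \<phi>]) simp_all
    qed
  next
    fix k assume "\<forall>\<phi>'\<in>\<Gamma>1. \<phi>' p = \<phi> p \<longrightarrow>
      k = cvfield_apply N X (field_apply F \<phi>') p - field_apply F (cvfield_apply N X \<phi>') p"
    then show "k = field_commutator X B \<phi> p"
      using \<phi> comm[OF \<phi>] by simp
  qed
  then show ?thesis
    using \<phi> unfolding field_deriv_def by auto
qed

lemma dom_field_deriv: "dom (field_deriv N \<Gamma>1 X F p) = {\<phi> p | \<phi>. \<phi> \<in> \<Gamma>1}"
  by (auto simp: field_deriv_def dom_def)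

text \<open>The adjoint relation passes from the dense set of values of \<open>\<Gamma>1\<close> to all vectors by
  continuity.\<close>

lemma smooth_bounded_field_commutator_extension:
  assumes B: "smooth_bounded_field B" and X: "X \<in> Vect N"
    and B': "\<And>p. bounded_clinear (B' p)"
    and ext: "\<And>\<phi> p. \<phi> \<in> \<Gamma>1 \<Longrightarrow> B' p (\<phi> p) = field_commutator X B \<phi> p"
  shows "smooth_bounded_field B'"
  unfolding smooth_bounded_field_def
proof (intro conjI allI ballI)
  show "bounded_clinear (B' p)" for p by (rule B')
  show "(\<lambda>p. B' p (\<phi> p)) \<in> smooth_maps N" if "\<phi> \<in> \<Gamma>1" for \<phi>
    using field_commutator_smooth[OF B X that] by (simp add: ext[OF that])
  fix \<psi> assume "\<psi> \<in> \<Gamma>2"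
  then obtain \<theta> where \<theta>: "\<theta> \<in> smooth_maps N"
      "\<forall>\<phi>\<in>\<Gamma>1. \<forall>p. cinner (\<psi> p) (field_commutator X B \<phi> p) = cinner (\<theta> p) (\<phi> p)"
    using field_commutator_adjoint[OF B X] by blast
  have "cinner (\<psi> p) (B' p h) - cinner (\<theta> p) h = 0" for p h
  proof (rule continuous_constant_on_closure[where f = "\<lambda>h. cinner (\<psi> p) (B' p h) - cinner (\<theta> p) h"])
    interpret b: bounded_bilinear "cinner :: 'b \<Rightarrow> 'b \<Rightarrow> complex" by (rule bounded_bilinear_cinner)
    interpret a: bounded_bilinear "cinner :: 'a \<Rightarrow> 'a \<Rightarrow> complex" by (rule bounded_bilinear_cinner)
    show "continuous_on (closure {\<phi> p | \<phi>. \<phi> \<in> \<Gamma>1}) (\<lambda>h. cinner (\<psi> p) (B' p h) - cinner (\<theta> p) h)"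
      by (intro continuous_on_diff b.continuous_on a.continuous_on continuous_on_const
          continuous_on_id linear_continuous_on bounded_clinear_bounded_linear B')
    show "h \<in> closure {\<phi> p | \<phi>. \<phi> \<in> \<Gamma>1}"
      using dense_submodule_values[OF M \<Gamma>1] by simp
    show "cinner (\<psi> p) (B' p h) - cinner (\<theta> p) h = 0" if "h \<in> {\<phi> p | \<phi>. \<phi> \<in> \<Gamma>1}" for h
      using that ext \<theta>(2) by auto
  qed
  then show "\<exists>\<theta>\<in>smooth_maps N. \<forall>p h. cinner (\<psi> p) (B' p h) = cinner (\<theta> p) h"
    using \<theta>(1) by auto
qed


lemma \<Gamma>2_near:
  assumes "e > 0"
  obtains \<psi> where "\<psi> \<in> \<Gamma>2" and "dist (\<psi> p) k < e"
proof -
  have "k \<in> closure {\<psi> p | \<psi>. \<psi> \<in> \<Gamma>2}"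
    using dense_submodule_values[OF M \<Gamma>2] by simp
  then obtain y where "y \<in> {\<psi> p | \<psi>. \<psi> \<in> \<Gamma>2}" "dist y k < e"
    using assms unfolding closure_approachable by blast
  then show thesis using that by blast
qed

section \<open>Star-strong continuity\<close>

lemma strongly_continuous_tendsto:
  assumes "strongly_continuous B" and "u \<longlonglongrightarrow> p"
  shows "(\<lambda>n. B (u n) h) \<longlonglongrightarrow> B p h"
proof -
  have "isCont (\<lambda>p. B p h) p"
    using assms(1) by (simp add: strongly_continuous_def continuous_on_eq_continuous_at)
  then show ?thesis
    using assms(2) by (rule isCont_tendsto_compose)
qed

text \<open>Along a convergent sequence the operators are uniformly bounded, hence so are their
  adjoints, and convergence of the adjoints needs to be checked on a dense set of vectors
  only. The values of elements of \<open>\<Gamma>2\<close> form such a set.\<close>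

lemma adjoint_field_continuous:
  assumes B: "smooth_bounded_field B" and sc: "strongly_continuous B"
    and G: "\<And>p k h. cinner k (B p h) = cinner (G p k) h"
  shows "continuous_on UNIV (\<lambda>p. G p k)"
proof (intro continuous_at_imp_continuous_on ballI continuous_at_sequentiallyI)
  fix p and u :: "nat \<Rightarrow> 'n" assume u: "u \<longlonglongrightarrow> p"
  obtain C where C: "C \<ge> 0" "\<And>n h. norm (B (u n) h) \<le> C * norm h"
    by (rule uniformly_bounded_of_convergent[of "\<lambda>n. B (u n)" "B p"])
       (rule smooth_bounded_fieldD(2)[OF B], rule strongly_continuous_tendsto[OF sc u], rule that, simp_all)
  have Cp: "norm (B p h) \<le> C * norm h" for h
    by (rule LIMSEQ_le_const2[OF tendsto_norm[OF strongly_continuous_tendsto[OF sc u]]])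
       (use C(2) in blast)
  show "(\<lambda>n. G (u n) k) \<longlonglongrightarrow> G p k"
  proof (rule metric_LIMSEQ_I)
    fix e :: real assume e: "e > 0"
    \<comment> \<open>Replacing \<open>k\<close> by \<open>\<psi>\<close> costs at most \<open>2 * (C * d)\<close> at \<open>u n\<close> and \<open>C * d\<close> at \<open>p\<close>.\<close>
    define d where "d = e / (4 * (C + 1))"
    have d: "d > 0" "C * d \<le> e / 4"
      using e C(1) by (simp_all add: d_def field_simps)
    obtain \<psi> where \<psi>: "\<psi> \<in> \<Gamma>2" "dist (\<psi> p) k < d"
      using \<Gamma>2_near[OF d(1)] .
    obtain \<theta> where \<theta>: "\<theta> \<in> smooth_maps N" "\<And>q h. cinner (\<psi> q) (B q h) = cinner (\<theta> q) h"
      using smooth_bounded_fieldD(4)[OF B \<psi>(1)] by blast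
    obtain n1 where n1: "\<And>n. n \<ge> n1 \<Longrightarrow> dist (\<psi> (u n)) (\<psi> p) < d"
      using metric_LIMSEQ_D[OF smooth_maps_tendsto[OF M \<Gamma>2D(1)[OF \<psi>(1)] u] d(1)] by blast
    obtain n2 where n2: "\<And>n. n \<ge> n2 \<Longrightarrow> dist (\<theta> (u n)) (\<theta> p) < e / 4"
      using metric_LIMSEQ_D[OF smooth_maps_tendsto[OF M \<theta>(1) u], of "e / 4"] e by auto
    have "dist (G (u n) k) (G p k) < e" if n: "n \<ge> max n1 n2" for n
    proof -
      have "dist k (\<psi> (u n)) \<le> 2 * d"
        using n1[of n] n \<psi>(2) dist_triangle3[of k "\<psi> (u n)" "\<psi> p"]
        by (simp add: dist_commute)
      then have "C * norm (k - \<psi> (u n)) \<le> C * (2 * d)"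
        unfolding dist_norm using C(1) by (rule mult_left_mono)
      moreover have "norm (G (u n) k - \<theta> (u n)) \<le> C * norm (k - \<psi> (u n))"
        by (rule adjoint_diff[OF G \<theta>(2) C(2) C(1)])
      ultimately have 1: "dist (G (u n) k) (\<theta> (u n)) \<le> 2 * (C * d)"
        by (simp add: dist_norm)
      have "norm (\<theta> p - G p k) \<le> C * norm (\<psi> p - k)"
        by (rule adjoint_diff[OF \<theta>(2) G Cp C(1)])
      also have "\<dots> \<le> C * d"
        using \<psi>(2) C(1) by (intro mult_left_mono) (simp_all add: dist_norm)
      finally have 2: "dist (\<theta> p) (G p k) \<le> C * d"
        by (simp add: dist_norm)
      have 3: "dist (\<theta> (u n)) (\<theta> p) < e / 4"
        using n2 n by simp
      show ?thesis
        using 1 2 3 d(2) dist_triangle[of "G (u n) k" "G p k" "\<theta> (u n)"]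
          dist_triangle[of "\<theta> (u n)" "G p k" "\<theta> p"] by linarith
    qed
    then show "\<exists>n0. \<forall>n\<ge>n0. dist (G (u n) k) (G p k) < e" by blast
  qed
qed

text \<open>The adjoints exist everywhere because they exist on the dense set of values of \<open>\<Gamma>2\<close>, so
  both families of generating sets have open preimages.\<close>

lemma star_strong_continuity:
  assumes B: "smooth_bounded_field B" and sc: "strongly_continuous B"
  shows "continuous_map euclidean star_strong_topology B"
proof -
  have ex: "\<exists>g. \<forall>h. cinner k (B p h) = cinner g h" for p k
  proof (rule adjoint_exists_from_dense[OF smooth_bounded_fieldD(2)[OF B]
        dense_submodule_values[OF M \<Gamma>2, of p]])
    fix k assume "k \<in> {\<psi> p | \<psi>. \<psi> \<in> \<Gamma>2}"
    then show "\<exists>g. \<forall>h. cinner k (B p h) = cinner g h"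
      using smooth_bounded_fieldD(4)[OF B] by blast
  qed
  define G where "G p k = (SOME g. \<forall>h. cinner k (B p h) = cinner g h)" for p k
  have G: "cinner k (B p h) = cinner (G p k) h" for p k h
    using someI_ex[OF ex[of k p]] unfolding G_def by blast
  have adj: "the (adjoint_op (everywhere_defined (B p)) k) = G p k" for p k
    using adjoint_op_everywhere[of k "B p" "G p k"] G by simp
  show ?thesis
    unfolding star_strong_topology_def
  proof (rule continuous_on_generated_topo)
    fix W :: "('a \<Rightarrow> 'b) set"
    assume "W \<in> {{T. bounded_clinear T \<and> T h \<in> V} | h V. open V} \<union>
      {{T. bounded_clinear T \<and> the (adjoint_op (everywhere_defined T) k) \<in> V} | k V. open V}"
    then consider h V where "open V" "W = {T. bounded_clinear T \<and> T h \<in> V}"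
      | k V where "open V" "W = {T. bounded_clinear T \<and> the (adjoint_op (everywhere_defined T) k) \<in> V}"
      by blast
    then show "openin euclidean (B -` W \<inter> topspace euclidean)"
    proof cases
      case 1
      then have "B -` W = (\<lambda>p. B p h) -` V"
        using smooth_bounded_fieldD(1)[OF B] by auto
      moreover have "open ((\<lambda>p. B p h) -` V)"
        using sc 1(1) by (simp add: strongly_continuous_def open_vimage)
      ultimately show ?thesis by simp
    next
      case 2
      then have "B -` W = (\<lambda>p. G p k) -` V"
        using smooth_bounded_fieldD(1)[OF B] by (auto simp: adj)
      moreover have "open ((\<lambda>p. G p k) -` V)"
        using adjoint_field_continuous[OF B sc G] 2(1) by (simp add: open_vimage)
      ultimately show ?thesis by simp
    qed
  next
    have "B p \<in> {T. bounded_clinear T \<and> T 0 \<in> UNIV}" for p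
      using smooth_bounded_fieldD(1)[OF B] by simp
    then show "B ` topspace euclidean \<subseteq> \<Union> ({{T. bounded_clinear T \<and> T h \<in> V} | h V. open V} \<union>
      {{T. bounded_clinear T \<and> the (adjoint_op (everywhere_defined T) k) \<in> V} | k V. open V})"
      by blast
  qed
qed

lemma star_strong_imp_strongly_continuous:
  assumes "continuous_map euclidean star_strong_topology B" and "\<And>p. bounded_clinear (B p)"
  shows "strongly_continuous B"
  unfolding strongly_continuous_def
proof
  fix h
  have "open ((\<lambda>p. B p h) -` V)" if "open V" for V
  proof -
    have "openin star_strong_topology {T. bounded_clinear T \<and> T h \<in> V}"
      unfolding star_strong_topology_def
      by (rule topology_generated_by_Basis) (use that in blast)
    then have "openin euclidean {p \<in> topspace euclidean. B p \<in> {T. bounded_clinear T \<and> T h \<in> V}}"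
      by (rule openin_continuous_map_preimage[OF assms(1)])
    moreover have "{p \<in> topspace euclidean. B p \<in> {T. bounded_clinear T \<and> T h \<in> V}}
        = (\<lambda>p. B p h) -` V"
      using assms(2) by auto
    ultimately show ?thesis by simp
  qed
  then show "continuous_on UNIV (\<lambda>p. B p h)"
    by (simp add: continuous_on_open_vimage)
qed


section \<open>Derivatives of strongly smooth fields\<close>

lemma strongly_smooth_imp_continuous: "strongly_smooth N B \<Longrightarrow> strongly_continuous B"
  unfolding strongly_smooth_def strongly_continuous_def using smooth_maps_continuous[OF M] by blast

text \<open>A strong limit of bounded operators, here of difference quotients, is bounded by the
  uniform boundedness principle.\<close>

lemma vfield_apply_field_bounded_linear:
  assumes B: "smooth_bounded_field B" and ss: "strongly_smooth N B"
  shows "bounded_linear (\<lambda>h. vfield_apply N Y (\<lambda>q. B q h) p)"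
proof (rule bounded_linear_limit)
  let ?q = "approach_seq N Y p"
  show "bounded_linear (\<lambda>h. real (Suc n) *\<^sub>R (B (?q n) h - B p h))" for n
    by (intro bounded_linear_compose[OF bounded_linear_scaleR_right] bounded_linear_sub
        smooth_bounded_fieldD(2)[OF B])
  show "(\<lambda>n. real (Suc n) *\<^sub>R (B (?q n) h - B p h)) \<longlonglongrightarrow> vfield_apply N Y (\<lambda>q. B q h) p" for h
    by (rule approach_seq_quotient[OF M]) (use ss in \<open>simp add: strongly_smooth_def\<close>)
qed

text \<open>The product rule for \<open>B \<phi>\<close> holds although \<open>B\<close> is differentiable only strongly, because
  difference quotients of \<open>\<phi>\<close> are multiplied by uniformly bounded operators.\<close>

lemma vfield_apply_field_product_rule:
  assumes B: "smooth_bounded_field B" and ss: "strongly_smooth N B" and \<phi>: "\<phi> \<in> \<Gamma>1"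
  shows "vfield_apply N Y (\<lambda>q. B q (\<phi> q)) p
    = vfield_apply N Y (\<lambda>q. B q (\<phi> p)) p + B p (vfield_apply N Y \<phi> p)"
proof (rule LIMSEQ_unique)
  let ?q = "approach_seq N Y p"
  show "(\<lambda>n. real (Suc n) *\<^sub>R (B (?q n) (\<phi> (?q n)) - B p (\<phi> p)))
      \<longlonglongrightarrow> vfield_apply N Y (\<lambda>q. B q (\<phi> q)) p"
    by (rule approach_seq_quotient[OF M smooth_bounded_fieldD(3)[OF B \<phi>]])
  have "(\<lambda>n. B (?q n) (real (Suc n) *\<^sub>R (\<phi> (?q n) - \<phi> p))) \<longlonglongrightarrow> B p (vfield_apply N Y \<phi> p)"
    by (rule strong_limit_apply[OF smooth_bounded_fieldD(2)[OF B]
          strongly_continuous_tendsto[OF strongly_smooth_imp_continuous[OF ss] approach_seq_tendsto[OF M]]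
          approach_seq_quotient[OF M \<Gamma>1D(1)[OF \<phi>]]])
  moreover have "(\<lambda>n. real (Suc n) *\<^sub>R (B (?q n) (\<phi> p) - B p (\<phi> p)))
      \<longlonglongrightarrow> vfield_apply N Y (\<lambda>q. B q (\<phi> p)) p"
    by (rule approach_seq_quotient[OF M]) (use ss in \<open>simp add: strongly_smooth_def\<close>)
  ultimately have lim: "(\<lambda>n. real (Suc n) *\<^sub>R (B (?q n) (\<phi> p) - B p (\<phi> p))
      + B (?q n) (real (Suc n) *\<^sub>R (\<phi> (?q n) - \<phi> p)))
      \<longlonglongrightarrow> vfield_apply N Y (\<lambda>q. B q (\<phi> p)) p + B p (vfield_apply N Y \<phi> p)"
    by (intro tendsto_add)
  have "r *\<^sub>R (B q (\<phi> p) - B p (\<phi> p)) + B q (r *\<^sub>R (\<phi> q - \<phi> p)) = r *\<^sub>R (B q (\<phi> q) - B p (\<phi> p))"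
    for q and r :: real
    using bounded_linear.linear[OF smooth_bounded_fieldD(2)[OF B, of q]]
    by (simp add: linear_scale linear_diff flip: scaleR_right_distrib)
  with lim show "(\<lambda>n. real (Suc n) *\<^sub>R (B (?q n) (\<phi> (?q n)) - B p (\<phi> p)))
      \<longlonglongrightarrow> vfield_apply N Y (\<lambda>q. B q (\<phi> p)) p + B p (vfield_apply N Y \<phi> p)"
    by (simp only:)
qed

text \<open>Differentiating \<open>B h\<close> for fixed vectors \<open>h\<close> gives the bounded extension of the commutator,
  and the extension satisfies the same assumptions as \<open>B\<close>, so that the step can be iterated.\<close>

lemma strongly_smooth_field_derivative:
  assumes B: "smooth_bounded_field B" and ss: "strongly_smooth N B" and X: "X \<in> Vect N"
  defines "B' \<equiv> \<lambda>p h. cvfield_apply N X (\<lambda>q. B q h) p"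
  shows "smooth_bounded_field B'" and "strongly_smooth N B'"
    and "\<And>\<phi> p. \<phi> \<in> \<Gamma>1 \<Longrightarrow> B' p (\<phi> p) = field_commutator X B \<phi> p"
proof -
  have sm: "(\<lambda>q. B q h) \<in> smooth_maps N" for h
    using ss by (simp add: strongly_smooth_def)
  show "strongly_smooth N B'"
    unfolding strongly_smooth_def B'_def using cvfield_apply_smooth[OF M X sm] by simp
  have blin: "bounded_linear (B' p)" for p
    unfolding B'_def cvfield_apply_def
    by (intro bounded_linear_add vfield_apply_field_bounded_linear[OF B ss]
        bounded_linear_compose[OF bounded_linear_scaleC])
  have "B' p (a *\<^sub>C h) = a *\<^sub>C B' p h" for p a h
  proof -
    have "B q (a *\<^sub>C h) = a *\<^sub>C B q h" for q
      using smooth_bounded_fieldD(1)[OF B] by (simp add: bounded_clinear_def)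
    then show ?thesis
      unfolding B'_def using cvfield_apply_scaleC[OF M sm] by simp
  qed
  with blin have bcl: "bounded_clinear (B' p)" for p
    by (simp add: bounded_clinear_def)
  show ext: "B' p (\<phi> p) = field_commutator X B \<phi> p" if \<phi>: "\<phi> \<in> \<Gamma>1" for \<phi> p
  proof -
    have cl: "B p (a + b) = B p a + B p b" "B p (\<i> *\<^sub>C a) = \<i> *\<^sub>C B p a" for a b
      using smooth_bounded_fieldD(1)[OF B, of p] bounded_linear.linear[OF smooth_bounded_fieldD(2)[OF B, of p]]
      by (auto simp: bounded_clinear_def linear_add)
    show ?thesis
      unfolding B'_def field_commutator_def cvfield_apply_def cl
        vfield_apply_field_product_rule[OF B ss \<phi>] scaleC_add_right by simp
  qed
  show "smooth_bounded_field B'"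
    by (rule smooth_bounded_field_commutator_extension[OF B X bcl ext])
qed

lemma iterated_field_deriv_extension:
  assumes "smooth_bounded_field A" and "strongly_smooth N A" and "set Xs \<subseteq> Vect N"
  shows "\<exists>B. smooth_bounded_field B \<and> strongly_smooth N B \<and>
    (\<forall>p h. h \<in> dom (foldr (field_deriv N \<Gamma>1) Xs (\<lambda>p. everywhere_defined (A p)) p) \<longrightarrow>
      foldr (field_deriv N \<Gamma>1) Xs (\<lambda>p. everywhere_defined (A p)) p h = Some (B p h)) \<and>
    (\<forall>\<phi>\<in>\<Gamma>1. \<forall>p. \<phi> p \<in> dom (foldr (field_deriv N \<Gamma>1) Xs (\<lambda>p. everywhere_defined (A p)) p))"
  using assms(3)
proof (induction Xs)
  case Nil
  show ?case
    using assms(1,2) by (intro exI[of _ A]) (auto simp: everywhere_defined_def)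
next
  case (Cons X Xs)
  define F where "F = foldr (field_deriv N \<Gamma>1) Xs (\<lambda>p. everywhere_defined (A p))"
  have X: "X \<in> Vect N" using Cons.prems by simp
  obtain B where B: "smooth_bounded_field B" "strongly_smooth N B"
    and FB: "\<And>p h. h \<in> dom (F p) \<Longrightarrow> F p h = Some (B p h)" "\<And>\<phi> p. \<phi> \<in> \<Gamma>1 \<Longrightarrow> \<phi> p \<in> dom (F p)"
    using Cons unfolding F_def by auto
  define B' where "B' p h = cvfield_apply N X (\<lambda>q. B q h) p" for p h
  have B': "smooth_bounded_field B'" "strongly_smooth N B'"
    "\<And>\<phi> p. \<phi> \<in> \<Gamma>1 \<Longrightarrow> B' p (\<phi> p) = field_commutator X B \<phi> p"
    unfolding B'_def[abs_def] by (rule strongly_smooth_field_derivative[OF B X]; assumption)+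
  have val: "field_deriv N \<Gamma>1 X F p (\<phi> p) = Some (B' p (\<phi> p))" if "\<phi> \<in> \<Gamma>1" for \<phi> p
    unfolding B'(3)[OF that] by (rule field_deriv_eq_commutator[OF B(1) X that]) (rule FB(1)[OF FB(2)])
  have "field_deriv N \<Gamma>1 X F p h = Some (B' p h)" if "h \<in> dom (field_deriv N \<Gamma>1 X F p)" for p h
    using that val unfolding dom_field_deriv by auto
  moreover have "\<phi> p \<in> dom (field_deriv N \<Gamma>1 X F p)" if "\<phi> \<in> \<Gamma>1" for \<phi> p
    using that unfolding dom_field_deriv by blast
  ultimately show ?case
    using B'(1,2) by (intro exI[of _ B']) (simp flip: F_def)
qed

lemma strongly_smooth_imp_star_strong_continuous:
  assumes "smooth_bounded_field A" and "strongly_smooth N A" and "set Xs \<subseteq> Vect N"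
  shows "star_strong_continuous (foldr (field_deriv N \<Gamma>1) Xs (\<lambda>p. everywhere_defined (A p)))"
proof -
  define F where "F = foldr (field_deriv N \<Gamma>1) Xs (\<lambda>p. everywhere_defined (A p))"
  obtain B where B: "smooth_bounded_field B" "strongly_smooth N B"
    and FB: "\<And>p h. h \<in> dom (F p) \<Longrightarrow> F p h = Some (B p h)" "\<And>\<phi> p. \<phi> \<in> \<Gamma>1 \<Longrightarrow> \<phi> p \<in> dom (F p)"
    using iterated_field_deriv_extension[OF assms] unfolding F_def by auto
  have "densely_defined (F p)" for p
  proof -
    have "{\<phi> p | \<phi>. \<phi> \<in> \<Gamma>1} \<subseteq> dom (F p)" using FB(2) by blast
    then have "closure {\<phi> p | \<phi>. \<phi> \<in> \<Gamma>1} \<subseteq> closure (dom (F p))" by (rule closure_mono)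
    then show ?thesis
      using dense_submodule_values[OF M \<Gamma>1, of p] by (auto simp: densely_defined_def)
  qed
  moreover have "the (F p h) = B p h" if "h \<in> dom (F p)" for p h
    using FB(1)[OF that] by simp
  moreover have "continuous_map euclidean star_strong_topology B"
    by (rule star_strong_continuity[OF B(1) strongly_smooth_imp_continuous[OF B(2)]])
  ultimately have "star_strong_continuous F"
    unfolding star_strong_continuous_def using smooth_bounded_fieldD(1)[OF B(1)] by blast
  then show ?thesis by (simp only: F_def)
qed


section \<open>Strong smoothness from strong continuity\<close>

lemma strongly_continuous_compact_bound:
  assumes B: "smooth_bounded_field B" and sc: "strongly_continuous B" and K: "compact K"
  obtains C where "C \<ge> 0" and "\<And>p h. p \<in> K \<Longrightarrow> norm (B p h) \<le> C * norm h"
proof -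
  have "\<exists>C. \<forall>p\<in>K. norm (B p h) \<le> C" for h
  proof -
    have "continuous_on K (\<lambda>p. B p h)"
      using sc unfolding strongly_continuous_def by (blast intro: continuous_on_subset)
    then have "bounded ((\<lambda>p. B p h) ` K)"
      by (intro compact_imp_bounded compact_continuous_image K)
    then show ?thesis by (auto simp: bounded_iff)
  qed
  then show thesis
    using uniform_boundedness[of K B] smooth_bounded_fieldD(2)[OF B] that by metis
qed

text \<open>Approximate the constant section \<open>h\<close> by elements \<open>\<phi> n\<close> of \<open>\<Gamma>1\<close>, uniformly on a compact
  neighbourhood together with their partial derivatives. There \<open>B (\<phi> n)\<close> tends to \<open>B h\<close>, and
  its partial derivatives \<open>B' b (\<phi> n) + B (\<partial>\<^sub>b \<phi> n)\<close> tend to \<open>B' b h\<close>, uniformly because the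
  operators are uniformly bounded on compact sets.\<close>

lemma strong_derivative_from_commutators:
  assumes c: "(U, x) \<in> N" and cs: "coordinate_system (E :: 'e set) k"
    and z0: "z0 \<in> x ` U" and r: "r > 0" and T: "cball z0 r \<subseteq> T" "T \<subseteq> x ` U"
    and Y: "\<And>b. Y b \<in> smooth_vfields N"
      "\<And>b z. z \<in> T \<Longrightarrow> Y b (U, x) (inv_into U x z) = b"
    and B: "smooth_bounded_field B" "strongly_continuous B"
    and B': "\<And>b. smooth_bounded_field (B' b)" "\<And>b. strongly_continuous (B' b)"
    and ext: "\<And>b \<phi> p. \<phi> \<in> \<Gamma>1 \<Longrightarrow> B' b p (\<phi> p) = field_commutator (Y b, \<lambda>_ _. 0) B \<phi> p"
    and z: "z \<in> ball z0 r"
  shows "((\<lambda>z. B (inv_into U x z) h) has_derivative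
    (\<lambda>v. \<Sum>b\<in>E. k b v *\<^sub>R B' b (inv_into U x z) h)) (at z)"
proof -
  define K where "K = inv_into U x ` cball z0 r"
  have cball: "cball z0 r \<subseteq> x ` U" using T by blast
  have "continuous_on (cball z0 r) (inv_into U x)"
    using chart_inv_continuous[OF M c] cball by (rule continuous_on_subset)
  then have K: "compact K"
    unfolding K_def by (intro compact_continuous_image compact_cball_finite_dim[OF cs])
  have KU: "K \<subseteq> U"
    using cball chart_inv_in[OF M c] unfolding K_def by blast
  obtain C where C: "C \<ge> 0" "\<And>p h. p \<in> K \<Longrightarrow> norm (B p h) \<le> C * norm h"
    using strongly_continuous_compact_bound[OF B K] by blast
  have "\<exists>C'. C' \<ge> 0 \<and> (\<forall>p h. p \<in> K \<longrightarrow> norm (B' b p h) \<le> C' * norm h)" for b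
    by (rule strongly_continuous_compact_bound[OF B' K, of b]) blast
  then obtain C' where C': "\<And>b. C' b \<ge> 0" "\<And>b p h. p \<in> K \<Longrightarrow> norm (B' b p h) \<le> C' b * norm h"
    by metis
  obtain L where L: "L > 0" "\<And>b v. b \<in> E \<Longrightarrow> \<bar>k b v\<bar> \<le> L * norm v"
    using coordinates_bounded[OF cs] by blast
  define \<epsilon> where "\<epsilon> n = inverse (real (Suc n))" for n
  have \<epsilon>: "\<epsilon> n > 0" for n by (simp add: \<epsilon>_def)
  have \<epsilon>_lim: "\<epsilon> \<longlonglongrightarrow> 0" unfolding \<epsilon>_def by (rule LIMSEQ_inverse_real_of_nat)
  have "\<exists>\<phi>. \<phi> \<in> \<Gamma>1 \<and> (\<forall>vs p. vs \<in> insert [] ((\<lambda>b. [b]) ` E) \<longrightarrow> p \<in> K \<longrightarrow>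
      norm (foldr dir_deriv vs (\<phi> \<circ> inv_into U x) (x p)
        - foldr dir_deriv vs ((\<lambda>_. h) \<circ> inv_into U x) (x p)) < \<epsilon> n)" for n
    by (rule dense_submodule_approx[OF \<Gamma>1 c K KU _ smooth_maps_const[OF M, of h] \<epsilon>[of n],
          where Vs = "insert [] ((\<lambda>b. [b]) ` E)"])
       (use coordinate_systemD(1)[OF cs] in simp, blast)
  then obtain \<phi> where \<phi>: "\<And>n. \<phi> n \<in> \<Gamma>1" and approx: "\<And>n vs p. vs \<in> insert [] ((\<lambda>b. [b]) ` E) \<Longrightarrow>
      p \<in> K \<Longrightarrow> norm (foldr dir_deriv vs (\<phi> n \<circ> inv_into U x) (x p)
        - foldr dir_deriv vs ((\<lambda>_. h) \<circ> inv_into U x) (x p)) < \<epsilon> n"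
    by metis
  have in_K: "inv_into U x z \<in> K" "x (inv_into U x z) = z" "inv_into U x z \<in> U" if "z \<in> ball z0 r" for z
  proof -
    have "z \<in> cball z0 r" using that by simp
    moreover from this have "z \<in> x ` U" using cball by blast
    ultimately show "inv_into U x z \<in> K" "x (inv_into U x z) = z" "inv_into U x z \<in> U"
      unfolding K_def by (auto intro: chart_inv_right[OF M c] chart_inv_in[OF M c])
  qed
  have approx0: "norm (\<phi> n p - h) \<le> \<epsilon> n" if "p \<in> K" for n p
    using approx[of "[]" p n] that KU chart_inv[OF M c] by (auto intro: less_imp_le)
  have approx1: "norm (dir_deriv b (\<phi> n \<circ> inv_into U x) (x p)) \<le> \<epsilon> n" if "p \<in> K" "b \<in> E" for n p b
    using approx[of "[b]" p n] that by (simp add: o_def dir_deriv_def)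
  define f where "f n z = B (inv_into U x z) (\<phi> n (inv_into U x z))" for n z
  have f_eq: "f n = (\<lambda>p. B p (\<phi> n p)) \<circ> inv_into U x" for n
    by (simp add: fun_eq_iff f_def)
  have smooth_f: "(\<lambda>p. B p (\<phi> n p)) \<in> smooth_maps N" for n
    by (rule smooth_bounded_fieldD(3)[OF B(1) \<phi>])
  have f_deriv: "(f n has_derivative (\<lambda>v. dir_deriv v (f n) z)) (at z)" if "z \<in> ball z0 r" for n z
    unfolding f_eq by (rule smooth_on_has_derivative[OF smooth_mapsD[OF smooth_f c]])
      (use that cball in auto)
  have partial: "dir_deriv b (f n) z = B' b (inv_into U x z) (\<phi> n (inv_into U x z))
      + B (inv_into U x z) (dir_deriv b (\<phi> n \<circ> inv_into U x) z)" if z: "z \<in> ball z0 r" for n b z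
  proof -
    define p where "p = inv_into U x z"
    have p: "p \<in> U" "x p = z" "Y b (U, x) p = b"
      using in_K[OF z] Y(2)[OF subsetD[OF T(1)], of z b] z unfolding p_def by auto
    have der: "cvfield_apply N (Y b, \<lambda>_ _. 0) \<xi> p = dir_deriv b (\<xi> \<circ> inv_into U x) z"
      if "\<xi> \<in> smooth_maps N" for \<xi> :: "'n \<Rightarrow> 'h::complex_hilbert_space"
      unfolding cvfield_apply_real[OF M that] vfield_apply_chart[OF M Y(1) that c p(1)] p(2,3)
      by (simp add: dir_deriv_def)
    have "B' b p (\<phi> n p) = dir_deriv b (f n) z - B p (dir_deriv b (\<phi> n \<circ> inv_into U x) z)"
      unfolding ext[OF \<phi>] field_commutator_def der[OF smooth_f] der[OF \<Gamma>1D(1)[OF \<phi>]] f_eq ..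
    then show ?thesis by (simp add: p_def)
  qed
  define W where "W = L * (\<Sum>b\<in>E. C' b + C)"
  have W: "W \<ge> 0"
    unfolding W_def using L(1) C(1) C'(1) by (intro mult_nonneg_nonneg sum_nonneg add_nonneg_nonneg) auto
  have est: "norm (dir_deriv v (f n) z - (\<Sum>b\<in>E. k b v *\<^sub>R B' b (inv_into U x z) h))
      \<le> (\<epsilon> n * W) * norm v" if z: "z \<in> ball z0 r" for n z v
  proof -
    let ?p = "inv_into U x z"
    have "dir_deriv v (f n) z = (\<Sum>b\<in>E. k b v *\<^sub>R dir_deriv b (f n) z)"
      by (rule linear_coordinate_expansion[OF cs has_derivative_linear[OF f_deriv[OF z]]])
    then have "norm (dir_deriv v (f n) z - (\<Sum>b\<in>E. k b v *\<^sub>R B' b ?p h))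
        = norm (\<Sum>b\<in>E. k b v *\<^sub>R (dir_deriv b (f n) z - B' b ?p h))"
      by (simp only: scaleR_diff_right sum_subtractf)
    also have "\<dots> \<le> (\<Sum>b\<in>E. (L * norm v) * ((C' b + C) * \<epsilon> n))"
    proof (rule sum_norm_le)
      fix b assume b: "b \<in> E"
      have "dir_deriv b (f n) z - B' b ?p h
          = B' b ?p (\<phi> n ?p - h) + B ?p (dir_deriv b (\<phi> n \<circ> inv_into U x) z)"
        unfolding partial[OF z]
        by (simp add: linear_diff[OF bounded_linear.linear[OF smooth_bounded_fieldD(2)[OF B'(1)]]])
      also have "norm \<dots> \<le> C' b * \<epsilon> n + C * \<epsilon> n"
      proof (rule norm_triangle_mono)
        show "norm (B' b ?p (\<phi> n ?p - h)) \<le> C' b * \<epsilon> n"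
          by (rule order_trans[OF C'(2)[OF in_K(1)[OF z]] mult_left_mono[OF approx0[OF in_K(1)[OF z]] C'(1)]])
        have "norm (dir_deriv b (\<phi> n \<circ> inv_into U x) z) \<le> \<epsilon> n"
          using approx1[OF in_K(1)[OF z] b, of n] in_K(2)[OF z] by simp
        then show "norm (B ?p (dir_deriv b (\<phi> n \<circ> inv_into U x) z)) \<le> C * \<epsilon> n"
          by (rule order_trans[OF C(2)[OF in_K(1)[OF z]] mult_left_mono[OF _ C(1)]])
      qed
      finally have "norm (dir_deriv b (f n) z - B' b ?p h) \<le> (C' b + C) * \<epsilon> n"
        by (simp add: distrib_right)
      then show "norm (k b v *\<^sub>R (dir_deriv b (f n) z - B' b ?p h)) \<le> (L * norm v) * ((C' b + C) * \<epsilon> n)"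
        unfolding norm_scaleR real_norm_def using L(1) by (intro mult_mono L(2) b) auto
    qed
    also have "\<dots> = (\<epsilon> n * W) * norm v"
      by (simp add: W_def sum_distrib_left sum_distrib_right mult_ac)
    finally show ?thesis .
  qed
  have lim: "(\<lambda>n. f n z) \<longlonglongrightarrow> B (inv_into U x z) h" if z: "z \<in> ball z0 r" for z
  proof (rule LIM_zero_cancel, rule Lim_null_comparison)
    show "\<forall>\<^sub>F n in sequentially. norm (f n z - B (inv_into U x z) h) \<le> C * \<epsilon> n"
    proof (intro always_eventually allI)
      fix n
      have "norm (B (inv_into U x z) (\<phi> n (inv_into U x z) - h)) \<le> C * \<epsilon> n"
        by (rule order_trans[OF C(2)[OF in_K(1)[OF z]] mult_left_mono[OF approx0[OF in_K(1)[OF z]] C(1)]])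
      then show "norm (f n z - B (inv_into U x z) h) \<le> C * \<epsilon> n"
        by (simp add: f_def linear_diff[OF bounded_linear.linear[OF smooth_bounded_fieldD(2)[OF B(1)]]])
    qed
    show "(\<lambda>n. C * \<epsilon> n) \<longlonglongrightarrow> 0" by (rule tendsto_mult_right_zero[OF \<epsilon>_lim])
  qed
  have "\<exists>g. \<forall>z\<in>ball z0 r. (\<lambda>n. f n z) \<longlonglongrightarrow> g z \<and>
      (g has_derivative (\<lambda>v. \<Sum>b\<in>E. k b v *\<^sub>R B' b (inv_into U x z) h)) (at z within ball z0 r)"
  proof (rule has_derivative_sequence[OF convex_ball])
    show "(f n has_derivative (\<lambda>v. dir_deriv v (f n) z)) (at z within ball z0 r)"
      if "z \<in> ball z0 r" for n z
      by (rule has_derivative_at_withinI[OF f_deriv[OF that]])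
    show "z0 \<in> ball z0 r" using r by simp
    show "(\<lambda>n. f n z0) \<longlonglongrightarrow> B (inv_into U x z0) h" using r by (intro lim) simp
    fix e :: real assume e: "e > 0"
    have "(\<lambda>n. \<epsilon> n * W) \<longlonglongrightarrow> 0" by (rule tendsto_mult_left_zero[OF \<epsilon>_lim])
    then have "\<forall>\<^sub>F n in sequentially. \<epsilon> n * W < e" using e by (rule order_tendstoD(2))
    then show "\<forall>\<^sub>F n in sequentially. \<forall>z\<in>ball z0 r. \<forall>v.
        norm (dir_deriv v (f n) z - (\<Sum>b\<in>E. k b v *\<^sub>R B' b (inv_into U x z) h)) \<le> e * norm v"
    proof (rule eventually_mono, intro ballI allI)
      fix n z and v :: 'e assume "\<epsilon> n * W < e" and z: "z \<in> ball z0 r"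
      then have "(\<epsilon> n * W) * norm v \<le> e * norm v" by (intro mult_right_mono) auto
      with est[OF z] show "norm (dir_deriv v (f n) z - (\<Sum>b\<in>E. k b v *\<^sub>R B' b (inv_into U x z) h))
          \<le> e * norm v" by (rule order_trans)
    qed
  qed
  then obtain g where g: "\<And>z. z \<in> ball z0 r \<Longrightarrow> (\<lambda>n. f n z) \<longlonglongrightarrow> g z"
    "\<And>z. z \<in> ball z0 r \<Longrightarrow> (g has_derivative (\<lambda>v. \<Sum>b\<in>E. k b v *\<^sub>R B' b (inv_into U x z) h))
      (at z within ball z0 r)"
    by blast
  have "(g has_derivative (\<lambda>v. \<Sum>b\<in>E. k b v *\<^sub>R B' b (inv_into U x z) h)) (at z)"
    using g(2)[OF z] unfolding at_within_open[OF z open_ball] .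
  then show ?thesis
  proof (rule has_derivative_transform_within_open[OF _ open_ball z])
    show "g z = B (inv_into U x z) h" if "z \<in> ball z0 r" for z
      by (rule LIMSEQ_unique[OF g(1)[OF that] lim[OF that]])
  qed
qed

text \<open>The previous lemma, applied to locally defined coordinate fields, expresses the partial
  derivatives of \<open>B h\<close> through fields \<open>B' h\<close> of the same class. Each order of differentiability
  for the whole class therefore yields the next one.\<close>

lemma commutator_closed_class_strongly_smooth:
  assumes class_field: "\<And>B. B \<in> S \<Longrightarrow> smooth_bounded_field B"
    and class_cont: "\<And>B. B \<in> S \<Longrightarrow> strongly_continuous B"
    and class_closed: "\<And>B X. B \<in> S \<Longrightarrow> X \<in> Vect N \<Longrightarrow>
      \<exists>B'\<in>S. \<forall>\<phi>\<in>\<Gamma>1. \<forall>p. B' p (\<phi> p) = field_commutator X B \<phi> p"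
    and "A \<in> S"
  shows "strongly_smooth N A"
proof -
  obtain E k where cs: "coordinate_system (E :: 'e set) k"
    by (rule model_coordinates[OF M])
  have deriv: "\<exists>T B'. open T \<and> z0 \<in> T \<and> T \<subseteq> x ` U \<and> (\<forall>b. B' b \<in> S) \<and>
      (\<forall>z\<in>T. \<forall>h. ((\<lambda>z. B (inv_into U x z) h) has_derivative
        (\<lambda>v. \<Sum>b\<in>E. k b v *\<^sub>R B' b (inv_into U x z) h)) (at z))"
    if B: "B \<in> S" and c: "(U, x) \<in> N" and z0: "z0 \<in> x ` U" for B U x z0
  proof -
    obtain T where T: "open T" "z0 \<in> T" "T \<subseteq> x ` U"
        "\<And>v. \<exists>Y\<in>smooth_vfields N. \<forall>z\<in>T. Y (U, x) (inv_into U x z) = v"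
      using coordinate_vfields[OF M c z0] by blast
    define Y where "Y v = (SOME Y. Y \<in> smooth_vfields N \<and> (\<forall>z\<in>T. Y (U, x) (inv_into U x z) = v))" for v
    have "Y v \<in> smooth_vfields N \<and> (\<forall>z\<in>T. Y v (U, x) (inv_into U x z) = v)" for v
    proof -
      have "\<exists>Y. Y \<in> smooth_vfields N \<and> (\<forall>z\<in>T. Y (U, x) (inv_into U x z) = v)"
        using T(4)[of v] by blast
      from someI_ex[OF this] show ?thesis unfolding Y_def .
    qed
    then have Y: "\<And>v. Y v \<in> smooth_vfields N" "\<And>v z. z \<in> T \<Longrightarrow> Y v (U, x) (inv_into U x z) = v"
      by blast+
    have X: "(Y b, \<lambda>_ _. 0) \<in> Vect N" for b
      using Y(1) zero_vfield[OF M] by (simp add: Vect_def)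
    define B' where "B' b = (SOME B'. B' \<in> S \<and>
      (\<forall>\<phi>\<in>\<Gamma>1. \<forall>p. B' p (\<phi> p) = field_commutator (Y b, \<lambda>_ _. 0) B \<phi> p))" for b
    have "B' b \<in> S \<and> (\<forall>\<phi>\<in>\<Gamma>1. \<forall>p. B' b p (\<phi> p) = field_commutator (Y b, \<lambda>_ _. 0) B \<phi> p)" for b
    proof -
      have "\<exists>B'. B' \<in> S \<and> (\<forall>\<phi>\<in>\<Gamma>1. \<forall>p. B' p (\<phi> p) = field_commutator (Y b, \<lambda>_ _. 0) B \<phi> p)"
        using class_closed[OF B X[of b]] by blast
      from someI_ex[OF this] show ?thesis unfolding B'_def .
    qed
    then have B': "\<And>b. B' b \<in> S"
        "\<And>b \<phi> p. \<phi> \<in> \<Gamma>1 \<Longrightarrow> B' b p (\<phi> p) = field_commutator (Y b, \<lambda>_ _. 0) B \<phi> p"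
      by blast+
    obtain r where r: "r > 0" "cball z0 r \<subseteq> T"
      using T(1,2) open_contains_cball by blast
    have "((\<lambda>z. B (inv_into U x z) h) has_derivative
        (\<lambda>v. \<Sum>b\<in>E. k b v *\<^sub>R B' b (inv_into U x z) h)) (at z)" if "z \<in> ball z0 r" for z h
      by (rule strong_derivative_from_commutators[OF c cs z0 r T(3) Y class_field[OF B] class_cont[OF B]
            class_field[OF B'(1)] class_cont[OF B'(1)] B'(2) that])
    moreover have "ball z0 r \<subseteq> x ` U" using r(2) T(3) ball_subset_cball by blast
    ultimately show ?thesis
      using r(1) B'(1) by (intro exI[of _ "ball z0 r"] exI[of _ B']) simp
  qed
  have "differentiable_upto n (x ` U) (\<lambda>z. B (inv_into U x z) h)"
    if "B \<in> S" "(U, x) \<in> N" for n B h U x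
    using that(1)
  proof (induction n arbitrary: B)
    case 0
    show ?case
      unfolding differentiable_upto_0
    proof
      fix z0 assume "z0 \<in> x ` U"
      then show "(\<lambda>z. B (inv_into U x z) h) differentiable (at z0)"
        using deriv[OF 0 that(2)] unfolding differentiable_def by blast
    qed
  next
    case (Suc n)
    have local: "\<exists>T. z0 \<in> T \<and> differentiable_upto (Suc n) T (\<lambda>z. B (inv_into U x z) h)"
      if z0: "z0 \<in> x ` U" for z0
    proof -
      obtain T B' where T: "open T" "z0 \<in> T" "T \<subseteq> x ` U" and B': "\<And>b. B' b \<in> S"
        and der: "\<And>z. z \<in> T \<Longrightarrow> ((\<lambda>z. B (inv_into U x z) h) has_derivative
          (\<lambda>v. \<Sum>b\<in>E. k b v *\<^sub>R B' b (inv_into U x z) h)) (at z)"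
        using deriv[OF Suc.prems \<open>(U, x) \<in> N\<close> z0] by blast
      have "differentiable_upto (Suc n) T (\<lambda>z. B (inv_into U x z) h)"
      proof (rule differentiable_upto_SucI[OF T(1) der])
        fix v
        show "differentiable_upto n T (\<lambda>z. \<Sum>b\<in>E. k b v *\<^sub>R B' b (inv_into U x z) h)"
        proof (rule differentiable_upto_sum[OF T(1)])
          fix b
          have "differentiable_upto n T (\<lambda>z. B' b (inv_into U x z) h)"
            by (rule differentiable_upto_mono[OF Suc.IH[OF B'] order_refl T(3)])
          then show "differentiable_upto n T (\<lambda>z. k b v *\<^sub>R B' b (inv_into U x z) h)"
            by (rule differentiable_upto_bounded_linear[OF T(1) bounded_linear_scaleR_right])
        qed
      qed
      with T(2) show ?thesis by blast
    qed
    show ?case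
      unfolding differentiable_upto_def
    proof (intro allI impI ballI)
      fix vs :: "'e list" and z0 assume vs: "length vs \<le> Suc n" and "z0 \<in> x ` U"
      then obtain T where T: "z0 \<in> T" "differentiable_upto (Suc n) T (\<lambda>z. B (inv_into U x z) h)"
        using local by blast
      show "foldr dir_deriv vs (\<lambda>z. B (inv_into U x z) h) differentiable (at z0)"
        using T(2)[unfolded differentiable_upto_def] vs T(1) by blast
    qed
  qed
  then have "smooth_on (x ` U) (\<lambda>z. A (inv_into U x z) h)" if "(U, x) \<in> N" for U x h
    unfolding smooth_on_iff_upto using \<open>A \<in> S\<close> that by blast
  then show ?thesis
    unfolding strongly_smooth_def smooth_maps_def by (auto simp: o_def)
qed

lemma everywhere_defined_star_strong_imp_strongly_continuous:
  assumes "star_strong_continuous (\<lambda>p. everywhere_defined (A p))"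
  shows "strongly_continuous A"
proof -
  obtain B where B: "\<And>p h. h \<in> dom (everywhere_defined (A p)) \<Longrightarrow>
        the (everywhere_defined (A p) h) = B p h"
      "continuous_map euclidean star_strong_topology B" "\<And>p. bounded_clinear (B p)"
    using assms unfolding star_strong_continuous_def by blast
  have "B = A"
    by (intro ext) (use B(1) in \<open>auto simp: everywhere_defined_def\<close>)
  then show ?thesis using star_strong_imp_strongly_continuous[OF B(2,3)] by simp
qed

lemma star_strong_continuous_iterated_extension:
  assumes A: "smooth_bounded_field A"
    and cont: "\<And>Xs. set Xs \<subseteq> Vect N \<Longrightarrow>
      star_strong_continuous (foldr (field_deriv N \<Gamma>1) Xs (\<lambda>p. everywhere_defined (A p)))"
    and Xs: "set Xs \<subseteq> Vect N"
  shows "\<exists>B. smooth_bounded_field B \<and> strongly_continuous B \<and>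
    (\<forall>\<phi>\<in>\<Gamma>1. \<forall>p. foldr (field_deriv N \<Gamma>1) Xs (\<lambda>p. everywhere_defined (A p)) p (\<phi> p)
      = Some (B p (\<phi> p)))"
  using Xs
proof (induction Xs)
  case Nil
  have "strongly_continuous A"
    using cont[of "[]"] by (intro everywhere_defined_star_strong_imp_strongly_continuous) simp
  then show ?case
    using A by (intro exI[of _ A]) (simp add: everywhere_defined_def)
next
  case (Cons X Xs)
  define F where "F = foldr (field_deriv N \<Gamma>1) Xs (\<lambda>p. everywhere_defined (A p))"
  have X: "X \<in> Vect N" using Cons.prems by simp
  obtain B where B: "smooth_bounded_field B" and FB: "\<And>\<phi> p. \<phi> \<in> \<Gamma>1 \<Longrightarrow> F p (\<phi> p) = Some (B p (\<phi> p))"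
    using Cons unfolding F_def by auto
  have "star_strong_continuous (field_deriv N \<Gamma>1 X F)"
    using cont[OF Cons.prems] by (simp add: F_def)
  then obtain B' where B': "\<And>p h. h \<in> dom (field_deriv N \<Gamma>1 X F p) \<Longrightarrow> the (field_deriv N \<Gamma>1 X F p h) = B' p h"
      "continuous_map euclidean star_strong_topology B'" "\<And>p. bounded_clinear (B' p)"
    unfolding star_strong_continuous_def by blast
  have val: "field_deriv N \<Gamma>1 X F p (\<phi> p) = Some (field_commutator X B \<phi> p)" if "\<phi> \<in> \<Gamma>1" for \<phi> p
    by (rule field_deriv_eq_commutator[where F = F, OF B X that]) (rule FB)
  have ext: "B' p (\<phi> p) = field_commutator X B \<phi> p" if "\<phi> \<in> \<Gamma>1" for \<phi> p
    using B'(1)[of "\<phi> p" p, OF domI, OF val[OF that]] val[OF that, of p] by simp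
  have "smooth_bounded_field B'"
    by (rule smooth_bounded_field_commutator_extension[OF B X B'(3) ext])
  moreover have "strongly_continuous B'"
    by (rule star_strong_imp_strongly_continuous[OF B'(2,3)])
  ultimately show ?case
    using val ext by (intro exI[of _ B']) (simp flip: F_def)
qed

text \<open>The bounded extensions of all iterated derivatives of \<open>A\<close> form a class of fields that is
  closed under commutators.\<close>

lemma star_strong_continuous_imp_strongly_smooth:
  assumes A: "smooth_bounded_field A"
    and cont: "\<And>Xs. set Xs \<subseteq> Vect N \<Longrightarrow>
      star_strong_continuous (foldr (field_deriv N \<Gamma>1) Xs (\<lambda>p. everywhere_defined (A p)))"
  shows "strongly_smooth N A"
proof -
  let ?F = "\<lambda>Xs. foldr (field_deriv N \<Gamma>1) Xs (\<lambda>p. everywhere_defined (A p))"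
  define S where "S = {B. smooth_bounded_field B \<and> strongly_continuous B \<and>
    (\<exists>Xs. set Xs \<subseteq> Vect N \<and> (\<forall>\<phi>\<in>\<Gamma>1. \<forall>p. ?F Xs p (\<phi> p) = Some (B p (\<phi> p))))}"
  have iter: "\<exists>B. smooth_bounded_field B \<and> strongly_continuous B \<and>
      (\<forall>\<phi>\<in>\<Gamma>1. \<forall>p. ?F Xs p (\<phi> p) = Some (B p (\<phi> p)))" if "set Xs \<subseteq> Vect N" for Xs
    by (rule star_strong_continuous_iterated_extension[OF A cont that])
  show ?thesis
  proof (rule commutator_closed_class_strongly_smooth[of S])
    show "smooth_bounded_field B" "strongly_continuous B" if "B \<in> S" for B
      using that by (auto simp: S_def)
    have "strongly_continuous A"
      using cont[of "[]"] by (intro everywhere_defined_star_strong_imp_strongly_continuous) simp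
    then show "A \<in> S"
      unfolding S_def using A by (intro CollectI conjI exI[of _ "[]"]) (auto simp: everywhere_defined_def)
  next
    fix B X assume "B \<in> S" and X: "X \<in> Vect N"
    then obtain Xs where B: "smooth_bounded_field B" and Xs: "set Xs \<subseteq> Vect N"
      and FB: "\<And>\<phi> p. \<phi> \<in> \<Gamma>1 \<Longrightarrow> ?F Xs p (\<phi> p) = Some (B p (\<phi> p))"
      unfolding S_def by blast
    have XXs: "set (X # Xs) \<subseteq> Vect N" using X Xs by simp
    obtain B' where B': "smooth_bounded_field B'" "strongly_continuous B'"
        "\<And>\<phi> p. \<phi> \<in> \<Gamma>1 \<Longrightarrow> ?F (X # Xs) p (\<phi> p) = Some (B' p (\<phi> p))"
      using iter[OF XXs] by blast
    have "B' p (\<phi> p) = field_commutator X B \<phi> p" if "\<phi> \<in> \<Gamma>1" for \<phi> p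
    proof -
      have "field_deriv N \<Gamma>1 X (?F Xs) p (\<phi> p) = Some (field_commutator X B \<phi> p)"
        by (rule field_deriv_eq_commutator[where F = "?F Xs", OF B X that]) (rule FB)
      then show ?thesis using B'(3)[OF that, of p] by simp
    qed
    moreover have "B' \<in> S"
      unfolding S_def using B' XXs by blast
    ultimately show "\<exists>B'\<in>S. \<forall>\<phi>\<in>\<Gamma>1. \<forall>p. B' p (\<phi> p) = field_commutator X B \<phi> p"
      by blast
  qed
qed

lemma smooth_op_fields_imp_smooth_bounded_field:
  assumes bcl: "\<And>p. bounded_clinear (A p)"
    and A: "(\<lambda>p. everywhere_defined (A p)) \<in> smooth_op_fields N \<Gamma>1 \<Gamma>2"
  shows "smooth_bounded_field A"
  unfolding smooth_bounded_field_def
proof (intro conjI allI ballI)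
  show "bounded_clinear (A p)" for p by (rule bcl)
  show "(\<lambda>p. A p (\<phi> p)) \<in> smooth_maps N" if "\<phi> \<in> \<Gamma>1" for \<phi>
  proof -
    have "field_apply (\<lambda>p. everywhere_defined (A p)) \<phi> \<in> smooth_maps N"
      using A that unfolding smooth_op_fields_def by blast
    then show ?thesis by (simp add: field_apply_def everywhere_defined_def)
  qed
  fix \<psi> assume \<psi>: "\<psi> \<in> \<Gamma>2"
  define \<theta> where "\<theta> = field_apply (\<lambda>p. adjoint_op (everywhere_defined (A p))) \<psi>"
  have "\<theta> \<in> smooth_maps N"
    using A \<psi> unfolding smooth_op_fields_def \<theta>_def by blast
  moreover have "cinner (\<psi> p) (A p h) = cinner (\<theta> p) h" for p h
  proof -
    have dom: "\<psi> p \<in> dom (adjoint_op (everywhere_defined (A p)))"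
      using A \<psi> unfolding smooth_op_fields_def by blast
    have univ: "dom (everywhere_defined (A p)) = UNIV" by (auto simp: everywhere_defined_def)
    obtain g where g: "\<And>h. cinner (\<psi> p) (A p h) = cinner g h"
      using dom by (auto simp: adjoint_op_def univ everywhere_defined_def split: if_splits)
    then show ?thesis
      using adjoint_op_everywhere[OF g] by (simp add: \<theta>_def field_apply_def)
  qed
  ultimately show "\<exists>\<theta>\<in>smooth_maps N. \<forall>p h. cinner (\<psi> p) (A p h) = cinner (\<theta> p) h"
    by blast
qed

end

theorem proposition2p3:
  fixes N :: "('n::{t2_space, second_countable_topology}, 'e::real_normed_vector) atlas"
    and \<Gamma>1 :: "('n \<Rightarrow> 'a::complex_hilbert_space) set"
    and \<Gamma>2 :: "('n \<Rightarrow> 'b::complex_hilbert_space) set"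
    and A :: "'n \<Rightarrow> 'a \<Rightarrow> 'b"
  assumes "smooth_manifold N"
    and "dense_smooth_submodule N \<Gamma>1"
    and "dense_smooth_submodule N \<Gamma>2"
    and "\<And>p. bounded_clinear (A p)"
    and "(\<lambda>p. everywhere_defined (A p)) \<in> smooth_op_fields N \<Gamma>1 \<Gamma>2"
  shows "strongly_smooth N A \<longleftrightarrow>
    (\<forall>Xs. set Xs \<subseteq> Vect N \<longrightarrow>
      star_strong_continuous (foldr (field_deriv N \<Gamma>1) Xs (\<lambda>p. everywhere_defined (A p))))"
proof -
  interpret dense_smooth_submodules N \<Gamma>1 \<Gamma>2
    by unfold_locales (rule assms)+
  have A: "smooth_bounded_field A"
    by (rule smooth_op_fields_imp_smooth_bounded_field[OF assms(4,5)])
  show ?thesis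
    using strongly_smooth_imp_star_strong_continuous[OF A]
      star_strong_continuous_imp_strongly_smooth[OF A] by blast
qed

end
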